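(* Let $m\ge1$ be an integer and $f(z)=\sum_{n\ge0}a_nz^{-n/m}\in\mathbb{C}[[z^{-1/m}]]$ a Gevrey-1 series. Assume there exists $\lambda>0$ such that the Borel transform $\widetilde f(\zeta)=\sum_{n\ge1}\frac{a_n\zeta^{n/m-1}}{\Gamma(n/m)}$ extends analytically to $\Omega_\lambda^\star$ and $$\exists A>0,\ \exists B>0,\ \forall\zeta\in\Omega_\lambda^\star:\ |\widetilde f(\zeta)\zeta^{\frac{m-1}{m}}|\le Ae^{B|\zeta|}.$$ Put $a_n^{(\lambda)}=\lambda^{\frac nm-1}a_n$ and define $d_n^{(\lambda)}$, $n\ge1$, recursively by $$d_n^{(\lambda)}=\frac{1}{\Gamma(\frac nm)}\Big(a_n^{(\lambda)}+\sum_{\substack{j\ge1,\ l\ge1\\ l+jm=n}}d_{\frac lm,j}\,a_l^{(\lambda)}\Big),\qquad d_{r,j}=\Big(\sum_{1\le p\le j}\frac{B_{j,p}\big(\frac{1!}{2},\frac{2!}{3},\dots,\frac{i!}{i+1},\dots\big)}{\Gamma(r-p)}\Big)\frac{\Gamma(r+j)}{j!}.$$ Then the generalized factorial series $$a_0+\lambda\sum_{n=1}^{+\infty}\frac{\Gamma(\frac nm)\Gamma(\lambda z)\,d_n^{(\lambda)}}{\Gamma(\lambda z+\frac nm)}$$ converges absolutely for $z\in P(\max(B,1/\lambda))$, and its sum equals the Borel sum $\mathrm{S}_0f(z)=a_0+\int_0^{+\infty}\widetilde f(\zeta)e^{-z\zeta}d\zeta$ there.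
   Context: $\Delta$ is the image of the open disc $D(1,1)=\{s:|s-1|<1\}$ under $s\mapsto-\ln s$ (principal logarithm); $\Delta_\lambda=\{\lambda\zeta:\zeta\in\Delta\}$ and $\Delta_\lambda^\star=\Delta_\lambda\setminus\{0\}$. $\mathbb{C}_m^\star$ is the $m$-sheeted covering of $\mathbb{C}^\star$: points $x=(|x|,\arg x)$, $\arg x\in\mathbb{R}/2\pi m\mathbb{Z}$, projection $\pi(x)=\dot x=|x|e^{i\arg x}$; $|\arg x|$ uses the representative in $]-m\pi,m\pi]$; $x^{k/m}$ has modulus $|x|^{k/m}$ and argument $\frac km\arg x$; complex values are read via the projection. $\Omega_\lambda^\star=\pi^{-1}(\Delta_\lambda^\star)$. $P(B)=\{z\in\mathbb{C}_m^\star:|\arg z|\le\pi/2,\ \Re(\dot z)>B\}$. Gevrey-1 means $|a_n|\le CK^n\Gamma(1+n/m)$. The Laplace integral is along the ray $\arg\zeta=0$. $1/\Gamma$ is the entire reciprocal Gamma function. $B_{j,p}$ are the partial exponential Bell polynomials: $B_{j,p}(x_1,x_2,\dots)=\sum\frac{j!}{\prod_i k_i!(i!)^{k_i}}\prod_i x_i^{k_i}$ over $k_i\ge0$ with $\sum k_i=p$, $\sum ik_i=j$. *)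

theory Defs
  imports "HOL-Analysis.Analysis"
begin

definition bell_partial :: "nat \<Rightarrow> nat \<Rightarrow> (nat \<Rightarrow> real) \<Rightarrow> real" where
  "bell_partial j p x =
     (\<Sum>k \<in> {k. (\<forall>i. k i \<noteq> 0 \<longrightarrow> i \<in> {1..j}) \<and> (\<Sum>i=1..j. k i) = p \<and> (\<Sum>i=1..j. i * k i) = j}.
        fact j / (\<Prod>i=1..j. fact (k i) * fact i ^ k i) * (\<Prod>i=1..j. x i ^ k i))"

definition bell_arg :: "nat \<Rightarrow> real" where
  "bell_arg i = fact i / real (i + 1)"

definition dcoef :: "real \<Rightarrow> nat \<Rightarrow> real" where
  "dcoef r j = (\<Sum>p=1..j. bell_partial j p bell_arg * rGamma (r - real p)) * Gamma (r + real j) / fact j"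

definition alam :: "nat \<Rightarrow> real \<Rightarrow> (nat \<Rightarrow> complex) \<Rightarrow> nat \<Rightarrow> complex" where
  "alam m lam a n = complex_of_real (lam powr (real n / real m - 1)) * a n"

definition dlam :: "nat \<Rightarrow> real \<Rightarrow> (nat \<Rightarrow> complex) \<Rightarrow> nat \<Rightarrow> complex" where
  "dlam m lam a n = complex_of_real (rGamma (real n / real m)) *
     (alam m lam a n +
      (\<Sum>j \<in> {j \<in> {1..n}. j * m < n}.
          complex_of_real (dcoef (real (n - j * m) / real m) j) * alam m lam a (n - j * m)))"

definition gevrey1 :: "nat \<Rightarrow> (nat \<Rightarrow> complex) \<Rightarrow> bool" where
  "gevrey1 m a \<longleftrightarrow> (\<exists>C K. \<forall>n. norm (a n) \<le> C * K ^ n * Gamma (1 + real n / real m))"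

definition Delta :: "complex set" where
  "Delta = (\<lambda>s. - Ln s) ` ball 1 1"

definition Delta_lam_star :: "real \<Rightarrow> complex set" where
  "Delta_lam_star lam = ((\<lambda>\<zeta>. complex_of_real lam * \<zeta>) ` Delta) - {0}"

text \<open>Logarithmic coordinates on the m-sheeted covering: a point x of C_m^* with
  (|x|, arg x) corresponds to w = ln|x| + i arg x, taken modulo 2 pi i m; so functions on
  (open subsets of) C_m^* are functions of w that are 2 pi i m periodic, and
  x^(k/m) = exp((k/m) w), pi(x) = exp w.  Omega_lambda^* = pi^{-1}(Delta_lambda^*) becomes:\<close>
definition Omega_log :: "real \<Rightarrow> complex set" where
  "Omega_log lam = {w. exp w \<in> Delta_lam_star lam}"

definition borel_term :: "nat \<Rightarrow> (nat \<Rightarrow> complex) \<Rightarrow> complex \<Rightarrow> nat \<Rightarrow> complex" where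
  "borel_term m a w n =
     (if n = 0 then 0
      else a n * exp (complex_of_real (real n / real m - 1) * w) * complex_of_real (rGamma (real n / real m)))"

definition fact_term :: "nat \<Rightarrow> real \<Rightarrow> (nat \<Rightarrow> complex) \<Rightarrow> complex \<Rightarrow> nat \<Rightarrow> complex" where
  "fact_term m lam a z n =
     complex_of_real (Gamma (real n / real m)) * Gamma (complex_of_real lam * z) * dlam m lam a n
       / Gamma (complex_of_real lam * z + complex_of_real (real n / real m))"

end

theory Submission
  imports Defs "HOL-Complex_Analysis.Complex_Analysis"
begin

text \<open>
  Substituting \<open>\<zeta> = - lam * ln (1 - u)\<close> and \<open>u = v ^ m\<close> turns \<open>\<Omega>\<close> into the punctured unit disc in \<open>v\<close>:
  the Borel transform times \<open>v ^ (m - 1)\<close> becomes a function \<open>H\<close> that is single-valued by periodicity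
  and holomorphic in the whole disc. Expanding \<open>(- ln (1 - u) / u) powr (r - 1)\<close> by the binomial
  series and the multinomial theorem shows that its Taylor coefficients are the \<open>d\<^sub>n\<close>.
  The growth hypothesis reads \<open>\<bar>H v\<bar> \<le> C * \<bar>1 - v ^ m\<bar> powr (- b)\<close> for any \<open>b > 1\<close> with
  \<open>lam * B \<le> b\<close>, so Cauchy's formula on \<open>\<bar>v\<bar> = 1 - 1 / (n + 2)\<close> gives \<open>d\<^sub>n = O(n powr (b - 1))\<close>:
  averaging over the circle gains one power of \<open>n\<close> over the maximum.
  Since \<open>\<integral>\<^sub>0\<^sup>\<infinity> (1 - exp (- s / lam)) powr (y - 1) * exp (- z * s) ds = lam * Beta y (lam * z)\<close> and
  \<open>Beta y x = O(y powr (- x))\<close>, choosing \<open>b < lam * Re z\<close> makes the series absolutely convergent and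
  justifies integrating it term by term.
\<close>

subsection \<open>Bell polynomials and powers of formal power series\<close>

text \<open>Vanishing off \<open>A\<close> makes each index function determined by its values on
  \<open>A\<close>, so the set is finite for finite \<open>A\<close>; it also matches the support
  condition in \<open>bell_partial\<close>.\<close>

definition multi_indices :: "'i set \<Rightarrow> nat \<Rightarrow> ('i \<Rightarrow> nat) set" where
  "multi_indices A p = {k. (\<forall>i. k i \<noteq> 0 \<longrightarrow> i \<in> A) \<and> sum k A = p}"

lemma finite_multi_indices:
  assumes "finite A"
  shows "finite (multi_indices A q)"
proof (rule finite_subset)
  show "multi_indices A q \<subseteq> {k. \<forall>i. (i \<in> A \<longrightarrow> k i \<in> {..q}) \<and> (i \<notin> A \<longrightarrow> k i = 0)}"
    using assms member_le_sum[of _ A] by (fastforce simp: multi_indices_def)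
  show "finite {k. \<forall>i. (i \<in> A \<longrightarrow> k i \<in> {..q}) \<and> (i \<notin> A \<longrightarrow> k i = 0)}"
    by (rule finite_set_of_finite_funs) (use assms in auto)
qed

text \<open>The value at the new point and the rest of the function are chosen independently; this
  recursion drives the induction for the multinomial theorem.\<close>

lemma sum_multi_indices_insert:
  assumes "finite A" "a \<notin> A"
  shows "(\<Sum>k\<in>multi_indices (insert a A) p. f k) =
         (\<Sum>r\<le>p. \<Sum>k\<in>multi_indices A (p - r). f (k(a := r)))"
proof -
  have upd: "sum (k(a := r)) A = sum k A" for k :: "'a \<Rightarrow> nat" and r
    by (rule sum.cong) (use assms in auto)
  have "(\<Sum>r\<le>p. \<Sum>k\<in>multi_indices A (p - r). f (k(a := r))) =
        (\<Sum>(r, k)\<in>(SIGMA r:{..p}. multi_indices A (p - r)). f (k(a := r)))"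
    by (rule sum.Sigma) (use assms finite_multi_indices in auto)
  also have "\<dots> = (\<Sum>k\<in>multi_indices (insert a A) p. f k)"
  proof (rule sum.reindex_bij_witness[of _ "\<lambda>k. (k a, k(a := 0))" "\<lambda>(r, k). k(a := r)"])
    fix k assume k: "k \<in> multi_indices (insert a A) p"
    then have "k a + sum k A = p" using assms by (simp add: multi_indices_def)
    then show "(k a, k(a := 0)) \<in> (SIGMA r:{..p}. multi_indices A (p - r))"
      using k upd[of k 0] by (auto simp: multi_indices_def)
  next
    fix y assume "y \<in> (SIGMA r:{..p}. multi_indices A (p - r))"
    then obtain r k where y: "y = (r, k)" "r \<le> p" "k \<in> multi_indices A (p - r)" by auto
    then have "k a = 0" using assms by (auto simp: multi_indices_def)
    then show "(\<lambda>k. (k a, k(a := 0))) ((\<lambda>(r, k). k(a := r)) y) = y"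
      by (auto simp: y)
    show "(\<lambda>(r, k). k(a := r)) y \<in> multi_indices (insert a A) p"
      using y upd assms by (auto simp: multi_indices_def)
  qed auto
  finally show ?thesis by simp
qed

text \<open>Induction on \<open>A\<close>: the binomial theorem splits off \<open>x a\<close>, and
  (p choose r) * (p - r)! = p! / r! supplies its divided power.\<close>

lemma fps_multinomial:
  fixes x :: "'i \<Rightarrow> 'a :: field_char_0 fps"
  assumes "finite A"
  shows "(\<Sum>i\<in>A. x i) ^ p = fps_const (fact p) *
           (\<Sum>k\<in>multi_indices A p. \<Prod>i\<in>A. fps_const (1 / fact (k i)) * x i ^ k i)"
  using assms
proof (induction A arbitrary: p rule: finite_induct)
  case empty
  have "multi_indices {} p = (if p = 0 then {\<lambda>_::'i. 0} else {})"
    by (auto simp: multi_indices_def)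
  then show ?case by (auto simp: power_0_left)
next
  case (insert a A)
  let ?t = "\<lambda>k i. fps_const (1 / fact (k i)) * x i ^ k i"
  have "(\<Sum>i\<in>insert a A. x i) ^ p = (\<Sum>r\<le>p. of_nat (p choose r) * x a ^ r * (\<Sum>i\<in>A. x i) ^ (p - r))"
    using insert by (simp add: binomial_ring)
  also have "\<dots> = (\<Sum>r\<le>p. fps_const (fact p) * (\<Sum>k\<in>multi_indices A (p - r). \<Prod>i\<in>insert a A. ?t (k(a := r)) i))"
  proof (rule sum.cong[OF refl])
    fix r assume r: "r \<in> {..p}"
    have prod: "(\<Prod>i\<in>insert a A. ?t (k(a := r)) i) = fps_const (1 / fact r) * x a ^ r * (\<Prod>i\<in>A. ?t k i)" for k
    proof -
      have "(\<Prod>i\<in>A. ?t (k(a := r)) i) = (\<Prod>i\<in>A. ?t k i)"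
        by (rule prod.cong) (use insert in auto)
      then show ?thesis using insert by simp
    qed
    have "(of_nat (p choose r) :: 'a fps) * fps_const (fact (p - r)) = fps_const (fact p) * fps_const (1 / fact r)"
      using r by (simp add: binomial_fact fps_of_nat[symmetric])
    then have "of_nat (p choose r) * x a ^ r * (fps_const (fact (p - r)) * S) =
        fps_const (fact p) * (fps_const (1 / fact r) * x a ^ r * S)" for S
      by (metis (no_types, opaque_lifting) mult.assoc mult.commute)
    then show "of_nat (p choose r) * x a ^ r * (\<Sum>i\<in>A. x i) ^ (p - r) =
        fps_const (fact p) * (\<Sum>k\<in>multi_indices A (p - r). \<Prod>i\<in>insert a A. ?t (k(a := r)) i)"
      by (simp only: insert.IH prod sum_distrib_left[symmetric])
  qed
  also have "\<dots> = fps_const (fact p) * (\<Sum>k\<in>multi_indices (insert a A) p. \<Prod>i\<in>insert a A. ?t k i)"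
    by (simp add: sum_multi_indices_insert insert sum_distrib_left del: prod.insert)
  finally show ?case .
qed

text \<open>Allows an infinite series to be cut off at degree j, since the multinomial theorem needs
  finitely many summands.\<close>

lemma fps_power_nth_cong:
  fixes f g :: "'a :: comm_ring_1 fps"
  assumes "\<And>i. i \<le> n \<Longrightarrow> fps_nth f i = fps_nth g i"
  shows "j \<le> n \<Longrightarrow> fps_nth (f ^ p) j = fps_nth (g ^ p) j"
proof (induction p arbitrary: j)
  case (Suc p)
  then show ?case by (auto simp: fps_mult_nth assms intro!: sum.cong)
qed simp

text \<open>Generating function of the Bell polynomials: arguments \<open>fact i * c i\<close>
  cancel the powers of i! in the definition. In the multinomial expansion each k contributes a
  monomial of degree \<open>\<Sum>i=1..j. i * k i\<close>, so taking the coefficient at j enforces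
  the weight condition.\<close>

lemma bell_partial_conv_fps_power:
  fixes c :: "nat \<Rightarrow> real"
  shows "complex_of_real (bell_partial j p (\<lambda>i. fact i * c i)) =
     fact j / fact p * fps_nth (Abs_fps (\<lambda>i. if i = 0 then 0 else complex_of_real (c i)) ^ p) j"
proof -
  define x where "x = (\<lambda>i. fps_const (complex_of_real (c i)) * fps_X ^ i)"
  let ?K = "{k. (\<forall>i. k i \<noteq> 0 \<longrightarrow> i \<in> {1..j}) \<and> (\<Sum>i=1..j. k i) = p \<and> (\<Sum>i=1..j. i * k i) = j}"
  have K: "?K = {k \<in> multi_indices {1..j} p. (\<Sum>i=1..j. i * k i) = j}"
    by (auto simp: multi_indices_def)
  have "fps_nth (Abs_fps (\<lambda>i. if i = 0 then 0 else complex_of_real (c i)) ^ p) j = fps_nth ((\<Sum>i=1..j. x i) ^ p) j"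
    by (rule fps_power_nth_cong[of j]) (auto simp: x_def fps_sum_nth if_distrib cong: if_cong)
  also have "\<dots> = fact p * (\<Sum>k\<in>multi_indices {1..j} p. fps_nth (\<Prod>i=1..j. fps_const (1 / fact (k i)) * x i ^ k i) j)"
    by (subst fps_multinomial) (auto simp: fps_sum_nth)
  also have "(\<Sum>k\<in>multi_indices {1..j} p. fps_nth (\<Prod>i=1..j. fps_const (1 / fact (k i)) * x i ^ k i) j) =
    (\<Sum>k\<in>multi_indices {1..j} p. if (\<Sum>i=1..j. i * k i) = j then (\<Prod>i=1..j. complex_of_real (c i) ^ k i / fact (k i)) else 0)"
  proof (rule sum.cong[OF refl])
    fix k
    have "(\<Prod>i=1..j. fps_const (1 / fact (k i)) * x i ^ k i) =
       (\<Prod>i=1..j. fps_const (complex_of_real (c i) ^ k i / fact (k i)) * fps_X ^ (i * k i))"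
      by (rule prod.cong) (auto simp: x_def power_mult_distrib power_mult fps_const_power[symmetric]
         fps_const_mult[symmetric] divide_inverse simp del: fps_const_mult fps_const_power)
    also have "\<dots> = fps_const (\<Prod>i=1..j. complex_of_real (c i) ^ k i / fact (k i)) * fps_X ^ (\<Sum>i=1..j. i * k i)"
      unfolding prod.distrib power_sum
      by (induction j) (auto simp: prod.nat_ivl_Suc' fps_const_mult[symmetric] simp del: fps_const_mult)
    finally show "fps_nth (\<Prod>i=1..j. fps_const (1 / fact (k i)) * x i ^ k i) j =
      (if (\<Sum>i=1..j. i * k i) = j then (\<Prod>i=1..j. complex_of_real (c i) ^ k i / fact (k i)) else 0)"
      by auto
  qed
  also have "\<dots> = (\<Sum>k\<in>?K. \<Prod>i=1..j. complex_of_real (c i) ^ k i / fact (k i))"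
    unfolding K by (rule sum.inter_filter[symmetric]) (rule finite_multi_indices, simp)
  also have "fact j / fact p * (fact p * \<dots>) = complex_of_real (bell_partial j p (\<lambda>i. fact i * c i))"
    unfolding bell_partial_def of_real_sum
    by (auto simp: sum_distrib_left prod_dividef prod.distrib power_mult_distrib intro!: sum.cong)
  finally show ?thesis ..
qed

subsection \<open>The quotient \<open>- Ln (1 - u) / u\<close>\<close>

text \<open>This is zeta / (lam * u) for zeta = - lam * ln (1 - u), with the limit filled in at u =
  0.\<close>

definition log_quot :: "complex \<Rightarrow> complex" where
  "log_quot u = (if u = 0 then 1 else - Ln (1 - u) / u)"

text \<open>Taylor series of \<open>log_quot\<close> minus 1. The zero constant term makes
  composition legitimate, and for i \<ge> 1 the coefficient is
  \<open>bell_arg i / fact i\<close>.\<close>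

definition log_quot_tail :: "complex fps" where
  "log_quot_tail = Abs_fps (\<lambda>i. if i = 0 then 0 else complex_of_real (1 / (real i + 1)))"

lemma log_quot_sums:
  assumes "norm u < 1"
  shows "(\<lambda>i. u ^ i / (of_nat i + 1)) sums log_quot u"
proof (cases "u = 0")
  case True
  then show ?thesis using powser_sums_zero[of "\<lambda>i. 1 / (of_nat i + 1 :: complex)"]
    by (simp add: log_quot_def)
next
  case False
  have "(\<lambda>n. - (u ^ n) / of_nat n) sums Ln (1 - u)"
    using Ln_series'[of "-u"] assms by simp
  then have "(\<lambda>n. - (u ^ Suc n) / of_nat (Suc n)) sums Ln (1 - u)"
    by (subst sums_Suc_iff) auto
  then have "(\<lambda>n. - (1 / u) * (- (u ^ Suc n) / of_nat (Suc n))) sums (- (1 / u) * Ln (1 - u))"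
    by (rule sums_mult)
  then show ?thesis using False by (simp add: log_quot_def add.commute)
qed

lemma log_quot_holomorphic: "log_quot holomorphic_on ball 0 1"
  by (rule power_series_holomorphic[where a = "\<lambda>i. 1 / (of_nat i + 1)"])
     (use log_quot_sums in auto)

text \<open>Needed for \<open>Ln (log_quot u)\<close> to be holomorphic. Otherwise Ln (1 - u) = c *
  u with c \<ge> 0; but for real u the two sides have opposite signs, and for other u the argument
  of 1 - u, which lies in (- pi / 2, pi / 2), has the sign opposite to Im u.\<close>

lemma log_quot_not_nonpos:
  assumes "norm u < 1"
  shows "log_quot u \<notin> \<real>\<^sub>\<le>\<^sub>0"
proof
  assume "log_quot u \<in> \<real>\<^sub>\<le>\<^sub>0"
  then obtain c where c: "log_quot u = - of_real c" "c \<ge> 0"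
    by (metis nonpos_Reals_cases add.inverse_inverse of_real_minus neg_0_le_iff_le)
  have u0: "u \<noteq> 0"
    using c by (auto simp: log_quot_def complex_eq_iff)
  have re: "Re (1 - u) > 0" using assms abs_Re_le_cmod[of u] by auto
  have nz: "1 - u \<noteq> 0" using re by (metis less_irrefl zero_complex.sel(1))
  have eq: "Ln (1 - u) = of_real c * u"
    using c u0 by (auto simp: log_quot_def field_simps)
  show False
  proof (cases "Im u = 0")
    case True
    then obtain x where x: "u = of_real x" by (metis complex_eq_iff Re_complex_of_real Im_complex_of_real)
    then have "x < 1" "x \<noteq> 0" using re u0 by auto
    have "Ln (1 - u) = of_real (ln (1 - x))"
      using \<open>x < 1\<close> x by (metis Ln_of_real diff_gt_0_iff_gt of_real_1 of_real_diff)
    with eq x have eq': "ln (1 - x) = c * x" by (metis of_real_eq_iff of_real_mult)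
    show False
    proof (cases "x > 0")
      case True
      then show False using eq' c \<open>x < 1\<close> by (smt (verit) ln_less_zero mult_nonneg_nonneg)
    next
      case False
      then have "ln (1 - x) > 0" using \<open>x \<noteq> 0\<close> by simp
      then show False using eq' c False by (simp add: mult_nonneg_nonpos zero_less_mult_iff)
    qed
  next
    case False
    have *: "Im (Ln (1 - u)) = c * Im u" using eq by simp
    have b: "\<bar>Im (Ln (1 - u))\<bar> < pi / 2" using re nz Re_Ln_pos_lt by blast
    have s: "Im (1 - u) = exp (Re (Ln (1 - u))) * sin (Im (Ln (1 - u)))"
      using nz by (metis Im_exp exp_Ln)
    show False
    proof (cases "Im u > 0")
      case True
      then have "Im (Ln (1 - u)) \<ge> 0" using * c by simp
      then have "sin (Im (Ln (1 - u))) \<ge> 0" using b by (intro sin_ge_zero) auto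
      then show False using s True by (smt (verit) exp_gt_zero minus_complex.sel(2) mult_nonneg_nonneg one_complex.sel(2))
    next
      case F: False
      then have "Im (Ln (1 - u)) \<le> 0" using * c by (simp add: mult_nonneg_nonpos)
      then have "sin (- Im (Ln (1 - u))) \<ge> 0" using b by (intro sin_ge_zero) auto
      then have "exp (Re (Ln (1 - u))) * sin (Im (Ln (1 - u))) \<le> 0" by (simp add: mult_nonneg_nonpos)
      then show False using s F False by auto
    qed
  qed
qed

lemma log_quot_nonzero: "norm u < 1 \<Longrightarrow> log_quot u \<noteq> 0"
  using log_quot_not_nonpos by fastforce

lemma log_quot_has_fps_expansion: "(\<lambda>u. log_quot u - 1) has_fps_expansion log_quot_tail"
proof (rule has_fps_expansionI)
  have "(\<lambda>n. fps_nth log_quot_tail n * u ^ n) sums (log_quot u - 1)" if "norm u < 1" for u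
  proof -
    have "(\<lambda>n. u ^ Suc n / (of_nat (Suc n) + 1)) sums (log_quot u - 1)"
      using log_quot_sums[OF that] by (subst sums_Suc_iff) simp
    then have "(\<lambda>n. fps_nth log_quot_tail (Suc n) * u ^ Suc n) sums (log_quot u - 1)"
      by (simp add: log_quot_tail_def field_simps)
    then show ?thesis by (subst (asm) sums_Suc_iff) (simp add: log_quot_tail_def)
  qed
  then show "\<forall>\<^sub>F u in nhds 0. (\<lambda>n. fps_nth log_quot_tail n * u ^ n) sums (log_quot u - 1)"
    by (intro eventually_nhds_in_open[THEN eventually_mono, of "ball 0 1"]) auto
qed

lemma log_quot_powr_has_fps_expansion:
  "(\<lambda>u. log_quot u powr c) has_fps_expansion (fps_binomial c oo log_quot_tail)"
proof -
  have "((\<lambda>x. (1 + x) powr c) \<circ> (\<lambda>u. log_quot u - 1)) has_fps_expansion (fps_binomial c oo log_quot_tail)"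
    by (intro has_fps_expansion_compose has_fps_expansion_binomial_complex log_quot_has_fps_expansion)
       (simp add: log_quot_tail_def)
  then show ?thesis by (simp add: o_def)
qed

section \<open>The recursion for d in terms of binomial series\<close>

lemma rGamma_conv_gbinomial:
  fixes r :: real
  assumes "r > 0"
  shows "rGamma (r - real p) = fact p * ((r - 1) gchoose p) * rGamma r"
  \<comment> \<open>The product (r - 1) ... (r - p) is a Pochhammer symbol started at r - p. With
    \<open>rGamma\<close> this includes the poles of Gamma at r - p, where both sides
    vanish.\<close>
  using pochhammer_rGamma[of "r - real p" p] gbinomial_pochhammer'[of "r - 1" p]
  by (simp add: algebra_simps)

text \<open>The factor \<open>rGamma (r + real j)\<close> is the prefactor in \<open>dlam\<close>
  and cancels the Gamma in \<open>dcoef\<close>. What remains is a sum over p of binomial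
  coefficients times powers of \<open>log_quot_tail\<close>, that is, a composition with the
  binomial series of exponent r - 1.\<close>

lemma dcoef_conv_fps:
  assumes "r > 0" "j \<ge> 1"
  shows "complex_of_real (rGamma (r + real j) * dcoef r j) =
     complex_of_real (rGamma r) * fps_nth (fps_binomial (complex_of_real (r - 1)) oo log_quot_tail) j"
proof -
  have "Gamma (r + real j) > 0" using assms by (simp add: Gamma_real_pos)
  then have G: "rGamma (r + real j) * Gamma (r + real j) = 1"
    by (simp add: rGamma_inverse_Gamma)
  have arg: "bell_arg = (\<lambda>i. fact i * (1 / (real i + 1)))"
    by (simp add: bell_arg_def fun_eq_iff)
  have bell: "complex_of_real (bell_partial j p bell_arg) = fact j / fact p * fps_nth (log_quot_tail ^ p) j" for p
    unfolding arg bell_partial_conv_fps_power log_quot_tail_def ..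
  have "complex_of_real (rGamma (r + real j) * dcoef r j) =
     complex_of_real ((rGamma (r + real j) * Gamma (r + real j)) * ((\<Sum>p=1..j. bell_partial j p bell_arg * rGamma (r - real p)) / fact j))"
    by (simp add: dcoef_def)
  also have "\<dots> = (\<Sum>p=1..j. complex_of_real (bell_partial j p bell_arg) * complex_of_real (rGamma (r - real p)) / fact j)"
    unfolding G by (simp add: sum_divide_distrib)
  also have "\<dots> = (\<Sum>p=1..j. complex_of_real (rGamma r) * ((complex_of_real (r - 1) gchoose p) * fps_nth (log_quot_tail ^ p) j))"
    by (rule sum.cong) (auto simp: bell rGamma_conv_gbinomial[OF assms(1)] gbinomial_prod_rev)
  \<comment> \<open>The composition also has a term p = 0, which is zero because the constant series
    1 has no coefficient at j \<ge> 1.\<close>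
  also have "\<dots> = complex_of_real (rGamma r) * (\<Sum>p=0..j. (complex_of_real (r - 1) gchoose p) * fps_nth (log_quot_tail ^ p) j)"
    using assms(2) by (simp add: sum.atLeast_Suc_atMost[of 0 j] sum_distrib_left)
  also have "\<dots> = complex_of_real (rGamma r) * fps_nth (fps_binomial (complex_of_real (r - 1)) oo log_quot_tail) j"
    by (simp add: fps_compose_nth)
  finally show ?thesis .
qed

text \<open>Since n / m = l / m + j for l = n - j * m, the outer \<open>rGamma\<close> merges with
  each \<open>dcoef\<close>; the isolated \<open>alam\<close> term becomes j = 0, where the series
  coefficient is 1.\<close>

lemma dlam_conv_fps:
  assumes "m \<ge> 1" "n \<ge> 1"
  shows "dlam m lam a n = (\<Sum>j | j * m < n. complex_of_real (rGamma (real (n - j * m) / real m)) *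
     alam m lam a (n - j * m) *
     fps_nth (fps_binomial (complex_of_real (real (n - j * m) / real m - 1)) oo log_quot_tail) j)"
    (is "_ = sum ?f _")
proof -
  have set: "{j. j * m < n} = insert 0 {j \<in> {1..n}. j * m < n}"
    using assms by (auto simp: Suc_le_eq) (metis One_nat_def Suc_le_eq less_imp_le_nat mult.right_neutral mult_le_mono2 order.trans)
  have 0: "?f 0 = complex_of_real (rGamma (real n / real m)) * alam m lam a n" by simp
  have eq: "complex_of_real (rGamma (real n / real m)) * complex_of_real (dcoef (real (n - j * m) / real m) j) *
      alam m lam a (n - j * m) = ?f j" if "j \<ge> 1" "j * m < n" for j
  proof -
    have "n - j * m > 0" using that by simp
    then have "real (n - j * m) / real m > 0"
      by (metis assms(1) divide_pos_pos of_nat_0_less_iff less_le_trans zero_less_one)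
    moreover have "real n / real m = real (n - j * m) / real m + real j"
      using that assms by (simp add: field_simps of_nat_diff)
    ultimately show ?thesis
      using dcoef_conv_fps[of "real (n - j * m) / real m" j] that by (simp add: mult_ac)
  qed
  have "dlam m lam a n = complex_of_real (rGamma (real n / real m)) * alam m lam a n +
     (\<Sum>j \<in> {j \<in> {1..n}. j * m < n}. complex_of_real (rGamma (real n / real m)) * complex_of_real (dcoef (real (n - j * m) / real m) j) *
      alam m lam a (n - j * m))"
    by (simp add: dlam_def algebra_simps sum_distrib_left)
  also have "(\<Sum>j \<in> {j \<in> {1..n}. j * m < n}. complex_of_real (rGamma (real n / real m)) * complex_of_real (dcoef (real (n - j * m) / real m) j) *
      alam m lam a (n - j * m)) = sum ?f {j \<in> {1..n}. j * m < n}"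
    by (rule sum.cong) (use eq in auto)
  finally show ?thesis unfolding set using 0 by simp
qed

section \<open>Estimates for the quotient and for the logarithm\<close>

lemma norm_log_quot_ge:
  assumes "norm u < 1"
  shows "norm (log_quot u) \<ge> exp (- 1)"
proof (cases "u = 0")
  case False
  define t where "t = - Ln (1 - u)"
  have "1 - u \<noteq> 0" using assms by auto
  then have u: "u = 1 - exp (- t)" by (simp add: t_def)
  have q: "norm (log_quot u) = norm t / norm u"
    using False by (simp add: log_quot_def t_def norm_divide)
  \<comment> \<open>For |t| \<ge> 1 this follows from |u| < 1; otherwise the remainder of the
    exponential series after its constant term gives it.\<close>
  have "norm u \<le> exp 1 * norm t"
  proof (cases "norm t \<ge> 1")
    case True
    have "1 * 1 \<le> exp 1 * norm t" using True by (intro mult_mono) auto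
    then show ?thesis using assms by simp
  next
    case False
    have "norm (exp (- t) - (\<Sum>k\<le>0. (- t) ^ k / fact k)) \<le> exp \<bar>Re (- t)\<bar> * norm (- t) ^ Suc 0 / fact 0"
      by (rule Taylor_exp)
    then have "norm u \<le> exp \<bar>Re t\<bar> * norm t" by (simp add: u norm_minus_commute)
    also have "\<dots> \<le> exp 1 * norm t"
      using False abs_Re_le_cmod[of t] by (intro mult_right_mono) auto
    finally show ?thesis .
  qed
  then have "exp (- 1) * norm u \<le> norm t"
    by (simp add: exp_minus field_simps)
  then show ?thesis unfolding q using False by (simp add: field_simps)
qed (simp add: log_quot_def)

text \<open>For |s| < 2 the bound 2 ln 2 - ln |s| on the real part covers |s| below and above 1 at
  once, and the argument costs pi. With s = 1 - u, exponential growth in |zeta| becomes a power of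
  |1 - u|.\<close>

lemma exp_norm_Ln_le:
  assumes "s \<noteq> 0" "norm s < 2" "b \<ge> 0"
  shows "exp (b * norm (Ln s)) \<le> exp (b * (2 * ln 2 + pi)) * norm s powr (- b)"
proof -
  have "norm (Ln s) \<le> \<bar>Re (Ln s)\<bar> + \<bar>Im (Ln s)\<bar>" by (rule cmod_le)
  also have "\<bar>Im (Ln s)\<bar> \<le> pi" using Im_Ln_le_pi[OF assms(1)] mpi_less_Im_Ln[OF assms(1)] by simp
  also have "\<bar>Re (Ln s)\<bar> \<le> 2 * ln 2 - ln (norm s)"
  proof -
    have "ln (norm s) < ln 2" using assms by simp
    moreover have "ln (2::real) > 0" by simp
    ultimately show ?thesis using assms(1) by (auto simp: Re_Ln abs_if)
  qed
  finally have "b * norm (Ln s) \<le> b * (2 * ln 2 + pi) + (- b) * ln (norm s)"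
    using assms(3) mult_left_mono[of "norm (Ln s)" "2 * ln 2 - ln (norm s) + pi" b] by (simp add: algebra_simps)
  then have "exp (b * norm (Ln s)) \<le> exp (b * (2 * ln 2 + pi) + (- b) * ln (norm s))" by simp
  also have "\<dots> = exp (b * (2 * ln 2 + pi)) * norm s powr (- b)"
    using assms(1) by (simp only: exp_add) (simp add: powr_def)
  finally show ?thesis .
qed

subsection \<open>The Beta function as a Laplace integral\<close>

text \<open>Substitution t = 1 - exp (- s / l) in Euler's integral. Its derivative exp (- s / l) / l
  supplies the missing power of 1 - t and is why \<open>f\<close> carries the factor l.\<close>

lemma has_absolute_integral_Beta_exp_real:
  fixes l x y :: real
  assumes l: "l > 0" and x: "x > 0" and y: "y > 0"
  shows "integrable (lebesgue_on {0<..}) (\<lambda>s. (1 - exp (- s / l)) powr (y - 1) * exp (- x * s))" (is ?A)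
    and "(LINT s|lebesgue_on {0<..}. (1 - exp (- s / l)) powr (y - 1) * exp (- x * s)) = l * Beta y (l * x)" (is ?B)
proof -
  define f where "f = (\<lambda>t. l * (t powr (y - 1) * (1 - t) powr (l * x - 1)))"
  define g where "g = (\<lambda>s. 1 - exp (- s / l))"
  define g' where "g' = (\<lambda>s. exp (- s / l) / l)"
  let ?h = "\<lambda>s. (1 - exp (- s / l)) powr (y - 1) * exp (- x * s)"
  have img: "g ` {0<..} = {0<..<1}"
  proof (intro equalityI subsetI)
    fix t assume t: "t \<in> {0<..<1::real}"
    have "g (- l * ln (1 - t)) = t" "- l * ln (1 - t) > 0"
      using t l by (auto simp: g_def mult_pos_neg)
    then show "t \<in> g ` {0<..}" by (metis greaterThan_iff imageI)
  qed (use l in \<open>auto simp: g_def\<close>)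
  have inj: "inj_on g {0<..}"
    using l by (auto simp: inj_on_def g_def)
  have der: "(g has_field_derivative g' s) (at s within {0<..})" for s
    unfolding g_def g'_def using l by (auto intro!: derivative_eq_intros)
  have fI: "(f has_integral l * Beta y (l * x)) {0<..<1}"
    unfolding f_def
    using has_integral_mult_right[OF has_integral_Beta_real[of y "l * x"], of l] l x y
    by (simp add: has_integral_Icc_iff_Ioo)
  have "f absolutely_integrable_on {0<..<1}"
    using fI l by (intro nonnegative_absolutely_integrable_1) (auto simp: f_def has_integral_iff)
  then have "f absolutely_integrable_on g ` {0<..} \<and> integral (g ` {0<..}) f = l * Beta y (l * x)"
    unfolding img using fI by (auto simp: has_integral_iff)
  then have *: "(\<lambda>s. \<bar>g' s\<bar> * f (g s)) absolutely_integrable_on {0<..} \<and>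
      integral {0<..} (\<lambda>s. \<bar>g' s\<bar> * f (g s)) = l * Beta y (l * x)"
    by (subst has_absolute_integral_change_of_variables_1'[OF _ der inj]) auto
  have eq: "\<bar>g' s\<bar> * f (g s) = ?h s" for s
  proof -
    have "exp (- s / l) powr (l * x - 1) * exp (- s / l) = exp (- x * s)"
      using l by (simp add: powr_def exp_add[symmetric] field_simps)
    then show ?thesis using l by (auto simp: f_def g_def g'_def mult.commute)
  qed
  have **: "?h absolutely_integrable_on {0<..}" "integral {0<..} ?h = l * Beta y (l * x)"
    using * unfolding eq by auto
  show ?A using **(1) by (simp add: set_integrable_eq)
  show ?B using set_lebesgue_integral_eq_integral(2)[OF **(1)] **(2)
    by (simp add: set_lebesgue_integral_def integral_restrict_space)
qed

lemma has_absolute_integral_Beta_exp_complex: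
  fixes l y :: real and z :: complex
  assumes l: "l > 0" and z: "Re z > 0" and y: "y > 0"
  shows "integrable (lebesgue_on {0<..}) (\<lambda>s. complex_of_real ((1 - exp (- s / l)) powr (y - 1)) * exp (- z * of_real s))" (is ?A)
    and "(LINT s|lebesgue_on {0<..}. complex_of_real ((1 - exp (- s / l)) powr (y - 1)) * exp (- z * of_real s))
       = of_real l * Beta (of_real y) (of_real l * z)" (is ?B)
proof -
  define M where "M = lebesgue_on {0::real<..}"
  have spM: "space M = {0<..}" by (simp add: M_def)
  define e where "e = (\<lambda>s. (1 - exp (- s / l)) powr (y - 1))"
  have cont_e: "continuous_on {0<..} e"
    unfolding e_def by (intro continuous_intros) (use l in auto)
  have e_nonneg: "e s \<ge> 0" for s by (simp add: e_def)
  have meas: "h \<in> borel_measurable M" if "continuous_on {0<..} h" for h :: "real \<Rightarrow> complex"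
    unfolding M_def by (rule continuous_imp_measurable_on_sets_lebesgue[OF that]) auto
  define I where "I = (\<lambda>w::complex. LINT s|M. of_real (e s) * exp (- w * of_real s))"
  have dom: "integrable M (\<lambda>s. e s * exp (- x * s))" if "x > 0" for x
    using has_absolute_integral_Beta_exp_real(1)[OF l that y] by (simp add: M_def e_def)
  have int: "integrable M (\<lambda>s. of_real (e s) * exp (- w * of_real s))" if "Re w > 0" for w :: complex
  proof (rule Bochner_Integration.integrable_bound[OF dom[OF that]])
    show "(\<lambda>s. of_real (e s) * exp (- w * of_real s)) \<in> borel_measurable M"
      by (intro meas continuous_intros cont_e)
    show "AE s in M. norm (of_real (e s) * exp (- w * of_real s)) \<le> norm (e s * exp (- Re w * s))"
      by (simp add: norm_mult e_nonneg)
  qed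
  from int[OF z] show ?A by (simp add: M_def e_def)
  \<comment> \<open>Around a real \<open>x0\<close> with \<open>norm (z - x0) < x0\<close> the integral is a power series in \<open>z - x0\<close>, so
    the formula continues analytically from the reals.\<close>
  obtain x0 where x0: "norm (z - of_real x0) < x0"
  proof -
    \<comment> \<open>|z - x0| < x0 means |z|^2 < 2 * Re z * x0; the summand 1 makes the inequality
      strict.\<close>
    define x0 where "x0 = ((Re z)\<^sup>2 + (Im z)\<^sup>2) / (2 * Re z) + 1"
    have pos: "x0 > 0" using z unfolding x0_def by (intro add_nonneg_pos) auto
    have "(norm (z - of_real x0))\<^sup>2 = (Re z)\<^sup>2 + (Im z)\<^sup>2 - 2 * Re z * x0 + x0\<^sup>2"
      by (simp only: cmod_power2) (simp add: power2_eq_square algebra_simps)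
    also have "2 * Re z * x0 = (Re z)\<^sup>2 + (Im z)\<^sup>2 + 2 * Re z"
      using z by (simp add: x0_def field_simps)
    finally have "(norm (z - of_real x0))\<^sup>2 < x0\<^sup>2" using z by simp
    then have "norm (z - of_real x0) < x0" using pos by (metis less_imp_le power2_less_imp_less)
    then show ?thesis by (rule that)
  qed
  then have x0pos: "x0 > 0" by (smt (verit) norm_ge_zero)
  let ?S = "ball (complex_of_real x0) x0"
  have Repos: "Re w > 0" if "w \<in> ?S" for w
    using that abs_Re_le_cmod[of "of_real x0 - w"] by (auto simp: dist_norm)
  \<comment> \<open>The k-th Taylor coefficient at x0 of the integrand as a function of w.\<close>
  define t where "t = (\<lambda>k s. of_real (e s) * exp (- of_real x0 * of_real s) * (- of_real s) ^ k / fact k :: complex)"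
  define c where "c = (\<lambda>k. LINT s|M. t k s)"
  have sums: "(\<lambda>k. c k * (w - of_real x0) ^ k) sums I w" if w: "w \<in> ?S" for w
  proof -
    define \<delta> where "\<delta> = w - of_real x0"
    have \<delta>: "norm \<delta> < x0" using w by (simp add: \<delta>_def dist_norm norm_minus_commute)
    \<comment> \<open>Dominates all partial sums: the absolute Taylor series adds up to exp
      (|\<delta>| * s), and |\<delta>| < x0 leaves exponential decay.\<close>
    let ?b = "\<lambda>s. e s * exp (- (x0 - norm \<delta>) * s)"
    have part: "norm (\<Sum>k<n. \<delta> ^ k * t k s) \<le> ?b s" "norm (\<delta> ^ n * t n s) \<le> ?b s" if "s > 0" for s n
    proof -
      have nt: "norm (\<delta> ^ k * t k s) = e s * exp (- x0 * s) * ((norm \<delta> * s) ^ k /\<^sub>R fact k)" for k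
        using that e_nonneg[of s] by (simp add: t_def norm_mult norm_divide norm_power power_mult_distrib field_simps)
      have E: "?b s = e s * exp (- x0 * s) * exp (norm \<delta> * s)"
        by (simp add: exp_add[symmetric] algebra_simps)
      have le: "(\<Sum>k\<in>K. (norm \<delta> * s) ^ k /\<^sub>R fact k) \<le> exp (norm \<delta> * s)" if "finite K" for K
        unfolding exp_def using \<open>s > 0\<close> that
        by (intro sum_le_suminf summable_exp_generic) auto
      have "norm (\<Sum>k<n. \<delta> ^ k * t k s) \<le> (\<Sum>k<n. norm (\<delta> ^ k * t k s))" by (rule norm_sum)
      also have "\<dots> = e s * exp (- x0 * s) * (\<Sum>k<n. (norm \<delta> * s) ^ k /\<^sub>R fact k)"
        unfolding nt sum_distrib_left ..
      also have "\<dots> \<le> ?b s"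
        unfolding E by (intro mult_left_mono le) (auto simp: e_nonneg)
      finally show "norm (\<Sum>k<n. \<delta> ^ k * t k s) \<le> ?b s" .
      show "norm (\<delta> ^ n * t n s) \<le> ?b s"
        unfolding E nt using le[of "{n}"] by (intro mult_left_mono) (auto simp: e_nonneg)
    qed
    have cont: "continuous_on {0<..} (\<lambda>s. \<delta> ^ k * t k s)" for k
      unfolding t_def by (intro continuous_intros cont_e) auto
    have dom': "integrable M ?b" using \<delta> by (intro dom) auto
    have itd: "integrable M (\<lambda>s. \<delta> ^ k * t k s)" for k
    proof (rule Bochner_Integration.integrable_bound[OF dom' meas[OF cont]])
      show "AE s in M. norm (\<delta> ^ k * t k s) \<le> norm (?b s)"
        using part(2)[of _ k] by (intro AE_I2) (auto simp: spM e_nonneg)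
    qed
    have "(\<lambda>n. LINT s|M. (\<Sum>k<n. \<delta> ^ k * t k s)) \<longlonglongrightarrow> (LINT s|M. of_real (e s) * exp (- w * of_real s))"
    proof (rule integral_dominated_convergence[where w = ?b])
      show "(\<lambda>s. of_real (e s) * exp (- w * of_real s)) \<in> borel_measurable M"
        by (intro meas continuous_intros cont_e)
      show "(\<lambda>s. \<Sum>k<n. \<delta> ^ k * t k s) \<in> borel_measurable M" for n
        by (intro meas continuous_on_sum cont)
      show "integrable M ?b" by (rule dom')
      show "AE s in M. norm (\<Sum>k<n. \<delta> ^ k * t k s) \<le> ?b s" for n
        using part(1)[of _ n] by (intro AE_I2) (auto simp: spM)
      show "AE s in M. (\<lambda>n. \<Sum>k<n. \<delta> ^ k * t k s) \<longlonglongrightarrow> of_real (e s) * exp (- w * of_real s)"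
      proof (rule AE_I2)
        fix s assume "s \<in> space M"
        have "(\<lambda>k. (- \<delta> * of_real s) ^ k /\<^sub>R fact k) sums exp (- \<delta> * of_real s)"
          by (rule exp_converges)
        then have "(\<lambda>k. of_real (e s) * exp (- of_real x0 * of_real s) * ((- \<delta> * of_real s) ^ k /\<^sub>R fact k)) sums
           (of_real (e s) * exp (- of_real x0 * of_real s) * exp (- \<delta> * of_real s))"
          by (rule sums_mult)
        moreover have "of_real (e s) * exp (- of_real x0 * of_real s) * ((- \<delta> * of_real s) ^ k /\<^sub>R fact k) = \<delta> ^ k * t k s" for k
        proof -
          have "(- \<delta> * of_real s) ^ k = \<delta> ^ k * (- of_real s) ^ k"
            by (simp flip: power_mult_distrib)
          then show ?thesis by (simp add: t_def scaleR_conv_of_real field_simps)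
        qed
        moreover have "of_real (e s) * exp (- of_real x0 * of_real s) * exp (- \<delta> * of_real s) = of_real (e s) * exp (- w * of_real s)"
          by (simp add: \<delta>_def mult.assoc exp_add[symmetric] algebra_simps)
        ultimately show "(\<lambda>n. \<Sum>k<n. \<delta> ^ k * t k s) \<longlonglongrightarrow> of_real (e s) * exp (- w * of_real s)"
          by (simp only: sums_def)
      qed
    qed
    also have "(\<lambda>n. LINT s|M. (\<Sum>k<n. \<delta> ^ k * t k s)) = (\<lambda>n. \<Sum>k<n. c k * \<delta> ^ k)"
      using itd by (simp add: c_def mult.commute)
    finally show ?thesis by (simp add: sums_def I_def \<delta>_def)
  qed
  have holI: "I holomorphic_on ?S"
    by (rule power_series_holomorphic[OF sums])
  have "I z - of_real l * Beta (of_real y) (of_real l * z) = 0"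
  proof (rule analytic_continuation[where S = ?S and U = "complex_of_real ` {x0<..<2*x0}" and \<xi> = "of_real x0"
        and f = "\<lambda>w. I w - of_real l * Beta (of_real y) (of_real l * w)"])
    have "of_real y \<notin> (\<int>\<^sub>\<le>\<^sub>0 :: complex set)"
      using y by (metis Re_complex_of_real nonpos_Ints_nonpos complex_nonpos_Reals_iff leD nonpos_Ints_subset_nonpos_Reals subsetD)
    moreover have "of_real l * w \<notin> \<int>\<^sub>\<le>\<^sub>0" if "w \<in> ?S" for w
    proof -
      have "Re (of_real l * w) > 0" using Repos[OF that] l by simp
      then show ?thesis using complex_nonpos_Reals_iff nonpos_Ints_subset_nonpos_Reals by (metis leD subsetD)
    qed
    ultimately show "(\<lambda>w. I w - of_real l * Beta (of_real y) (of_real l * w)) holomorphic_on ?S"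
      by (intro holomorphic_intros holI) auto
    show "complex_of_real ` {x0<..<2*x0} \<subseteq> ?S"
      by (auto simp: dist_norm norm_of_real simp flip: of_real_diff)
    show "of_real x0 islimpt complex_of_real ` {x0<..<2*x0}"
      unfolding islimpt_approachable
    proof (intro allI impI)
      fix \<epsilon> :: real assume "\<epsilon> > 0"
      define x where "x = x0 + min (\<epsilon> / 2) (x0 / 2)"
      have "x \<in> {x0<..<2*x0}" "x \<noteq> x0" "dist (complex_of_real x) (of_real x0) < \<epsilon>"
        using \<open>\<epsilon> > 0\<close> x0pos by (auto simp: x_def dist_norm simp flip: of_real_diff)
      then show "\<exists>x'\<in>complex_of_real ` {x0<..<2*x0}. x' \<noteq> of_real x0 \<and> dist x' (of_real x0) < \<epsilon>"
        by (intro bexI[of _ "complex_of_real x"]) auto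
    qed
    fix w assume "w \<in> complex_of_real ` {x0<..<2*x0}"
    then obtain x where x: "w = of_real x" "x > 0" using x0pos by auto
    have "I w = (LINT s|M. complex_of_real (e s * exp (- x * s)))"
      by (simp add: I_def x exp_of_real[symmetric])
    also have "\<dots> = of_real (LINT s|M. e s * exp (- x * s))" by (rule integral_complex_of_real)
    also have "(LINT s|M. e s * exp (- x * s)) = l * Beta y (l * x)"
      using has_absolute_integral_Beta_exp_real(2)[OF l x(2) y] by (simp add: M_def e_def)
    finally show "I w - of_real l * Beta (of_real y) (of_real l * w) = 0"
      by (simp add: x Beta_complex_of_real[symmetric])
  qed (use x0 x0pos in \<open>auto simp: dist_norm norm_minus_commute\<close>)
  then show ?B by (simp add: I_def M_def e_def)
qed

section \<open>Decay of the Beta function\<close>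

lemma Beta_real_le:
  fixes x y :: real
  assumes "x > 0" "y > 1"
  shows "Beta y x \<le> Gamma x * (y - 1) powr (- x)"
proof -
  have pos: "Gamma y > 0" "Gamma (y - 1) > 0" "Gamma (y + x) > 0" "Gamma x > 0"
    using assms by (auto intro!: Gamma_real_pos)
  \<comment> \<open>The slope of \<open>ln \<circ> Gamma\<close> on \<open>[y - 1, y]\<close> is \<open>ln (y - 1)\<close> and bounds that on \<open>[y, y + x]\<close>.\<close>
  have cv: "convex_on {0<..} (ln \<circ> Gamma :: real \<Rightarrow> real)" by (rule log_convex_Gamma_real)
  \<comment> \<open>The weight that makes y a convex combination of y + x and y - 1.\<close>
  define t where "t = x / (x + 1)"
  have t: "t \<ge> 0" "t \<le> 1" using assms by (auto simp: t_def)
  have t': "1 - t = 1 / (x + 1)" using assms by (simp add: t_def field_simps)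
  have "y = (1 - t) * (y + x) + t * (y - 1)"
  proof -
    have "(1 - t) * (y + x) + t * (y - 1) = ((y + x) + x * (y - 1)) / (x + 1)"
      unfolding t' by (simp add: t_def add_divide_distrib)
    also have "(y + x) + x * (y - 1) = y * (x + 1)" by (simp add: algebra_simps)
    finally show ?thesis using assms by simp
  qed
  then have "ln (Gamma y) \<le> (1 - t) * ln (Gamma (y + x)) + t * ln (Gamma (y - 1))"
    using convex_onD[OF cv t, of "y + x" "y - 1"] assms by simp
  then have "(x + 1) * ln (Gamma y) \<le> (x + 1) * ((1 - t) * ln (Gamma (y + x)) + t * ln (Gamma (y - 1)))"
    using assms by (intro mult_left_mono) auto
  also have "\<dots> = ((x + 1) * (1 - t)) * ln (Gamma (y + x)) + ((x + 1) * t) * ln (Gamma (y - 1))"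
    by (simp add: algebra_simps)
  also have "\<dots> = ln (Gamma (y + x)) + x * ln (Gamma (y - 1))"
    using assms t' by (simp add: t_def)
  finally have *: "x * (ln (Gamma y) - ln (Gamma (y - 1))) \<le> ln (Gamma (y + x)) - ln (Gamma y)"
    by (simp add: algebra_simps)
  have "Gamma y = (y - 1) * Gamma (y - 1)"
    using assms Gamma_plus1[of "y - 1"] nonpos_Ints_nonpos[of "y - 1"] by fastforce
  then have "ln (Gamma y) = ln (y - 1) + ln (Gamma (y - 1))"
    using assms pos ln_mult_pos[of "y - 1" "Gamma (y - 1)"] by simp
  with * have "ln (Gamma y) - ln (Gamma (y + x)) \<le> - x * ln (y - 1)" by simp
  then have "exp (ln (Gamma y) - ln (Gamma (y + x))) \<le> exp (- x * ln (y - 1))" by simp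
  then have "Gamma y / Gamma (y + x) \<le> (y - 1) powr (- x)"
    using pos assms by (simp add: exp_diff powr_def)
  then have "Gamma x * (Gamma y / Gamma (y + x)) \<le> Gamma x * (y - 1) powr (- x)"
    using pos by (intro mult_left_mono) auto
  then show ?thesis by (simp add: Beta_def mult_ac)
qed

subsection \<open>Taylor coefficients under a power growth bound\<close>

text \<open>Jordan's inequality: |1 - cis x| = 2 |sin (x / 2)|, and by concavity the sine lies above
  its chord on [0, pi / 2].\<close>

lemma norm_one_minus_cis_ge:
  assumes "\<bar>x\<bar> \<le> pi"
  shows "norm (1 - cis x) \<ge> 2 * \<bar>x\<bar> / pi"
proof -
  have "convex_on {0..pi/2} (\<lambda>x. - sin x)"
    by (rule f''_ge0_imp_convex[where f' = "\<lambda>x. - cos x" and f'' = sin])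
       (auto intro!: derivative_eq_intros sin_ge_zero)
  from convex_onD[OF this, of "\<bar>x\<bar> / pi" 0 "pi / 2"] assms
  have "sin (\<bar>x\<bar> / 2) \<ge> \<bar>x\<bar> / pi" by (simp add: field_simps)
  moreover have "norm (1 - cis x) = 2 * \<bar>sin (x / 2)\<bar>"
    using dist_exp_i_1[of x] by (simp add: cis_conv_exp norm_minus_commute)
  moreover have "\<bar>sin (x / 2)\<bar> = \<bar>sin (\<bar>x\<bar> / 2)\<bar>" by (simp add: abs_if)
  ultimately show ?thesis by (simp only: times_divide_eq_right[symmetric]) linarith
qed

text \<open>The lower bounds 1 - \<rho> and 2 |x| / pi - (1 - \<rho>), combined with weights 3/4 and
  1/4.\<close>

lemma norm_one_minus_rcis_ge:
  assumes "\<bar>x\<bar> \<le> pi" "0 \<le> \<rho>" "\<rho> \<le> 1"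
  shows "norm (1 - of_real \<rho> * cis x) \<ge> ((1 - \<rho>) + \<bar>x\<bar> / pi) / 2"
proof -
  have n: "norm (of_real \<rho> * cis x) = \<rho>" using assms by (simp add: norm_mult)
  then have 1: "norm (1 - of_real \<rho> * cis x) \<ge> 1 - \<rho>"
    using norm_triangle_ineq2[of 1 "of_real \<rho> * cis x"] by simp
  have "norm (of_real \<rho> * cis x - cis x) = 1 - \<rho>"
  proof -
    have "of_real \<rho> * cis x - cis x = - of_real (1 - \<rho>) * cis x" by (simp add: algebra_simps)
    then show ?thesis using assms by (simp add: norm_mult del: of_real_diff)
  qed
  then have "norm (1 - cis x) \<le> norm (1 - of_real \<rho> * cis x) + (1 - \<rho>)"
    using norm_triangle_ineq[of "1 - of_real \<rho> * cis x" "of_real \<rho> * cis x - cis x"] by simp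
  with 1 norm_one_minus_cis_ge[OF assms(1)] show ?thesis by simp
qed

text \<open>The integrand peaks at \<open>\<epsilon> powr (- b)\<close>, yet its integral carries
  one more power of \<epsilon>: this is the gain from averaging over a circle. Each side of c has an
  explicit primitive, and b > 1 gives the terms from the endpoints 0 and 1 a sign that lets them be
  dropped.\<close>

lemma integral_shifted_abs_powr_le:
  fixes b c \<epsilon> :: real
  assumes "b > 1" "\<epsilon> > 0" "0 \<le> c" "c \<le> 1"
  shows "(\<lambda>x. (\<epsilon> + \<bar>x - c\<bar>) powr (- b)) integrable_on {0..1}"
    and "integral {0..1} (\<lambda>x. (\<epsilon> + \<bar>x - c\<bar>) powr (- b)) \<le> 2 * \<epsilon> powr (1 - b) / (b - 1)"
proof -
  let ?f = "\<lambda>x. (\<epsilon> + \<bar>x - c\<bar>) powr (- b)"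
  have 1: "(?f has_integral ((\<epsilon> + (c - c)) powr (1 - b) / (b - 1) - (\<epsilon> + (c - 0)) powr (1 - b) / (b - 1))) {0..c}"
  proof (rule fundamental_theorem_of_calculus)
    fix x assume x: "x \<in> {0..c}"
    have "((\<lambda>x. (\<epsilon> + (c - x)) powr (1 - b) / (b - 1)) has_real_derivative ?f x) (at x within {0..c})"
      using assms x by (auto intro!: derivative_eq_intros simp: divide_simps) (simp add: algebra_simps)
    then show "((\<lambda>x. (\<epsilon> + (c - x)) powr (1 - b) / (b - 1)) has_vector_derivative ?f x) (at x within {0..c})"
      by (simp add: has_real_derivative_iff_has_vector_derivative)
  qed (use assms in auto)
  have 2: "(?f has_integral (- ((\<epsilon> + (1 - c)) powr (1 - b) / (b - 1)) - - ((\<epsilon> + (c - c)) powr (1 - b) / (b - 1)))) {c..1}"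
  proof (rule fundamental_theorem_of_calculus)
    fix x assume x: "x \<in> {c..1}"
    have "((\<lambda>x. - ((\<epsilon> + (x - c)) powr (1 - b) / (b - 1))) has_real_derivative ?f x) (at x within {c..1})"
      using assms x by (auto intro!: derivative_eq_intros simp: divide_simps) (simp add: algebra_simps)
    then show "((\<lambda>x. - ((\<epsilon> + (x - c)) powr (1 - b) / (b - 1))) has_vector_derivative ?f x) (at x within {c..1})"
      by (simp add: has_real_derivative_iff_has_vector_derivative)
  qed (use assms in auto)
  note 3 = has_integral_combine[OF assms(3,4) 1 2]
  from 3 show "?f integrable_on {0..1}" by blast
  have "(\<epsilon> + (c - 0)) powr (1 - b) / (b - 1) \<ge> 0" "(\<epsilon> + (1 - c)) powr (1 - b) / (b - 1) \<ge> 0"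
    using assms by auto
  with integral_unique[OF 3] show "integral {0..1} ?f \<le> 2 * \<epsilon> powr (1 - b) / (b - 1)"
    by simp
qed

lemma norm_one_minus_power_powr_le:
  fixes r x b :: real
  assumes m: "m \<ge> 1" and r: "0 \<le> r" "r < 1" and x: "0 \<le> x" "x \<le> 1" and b: "b \<ge> 0"
  defines "v \<equiv> of_real r * exp (2 * of_real pi * \<i> * of_real x)"
  shows "norm (1 - v ^ m) powr (- b) \<le> 2 powr b * (\<Sum>k\<le>m. ((1 - r) + \<bar>x - real k / real m\<bar>) powr (- b))"
proof -
  \<comment> \<open>The nearest \<open>m\<close>-th root of unity decides; summing over all of them loses only a constant.\<close>
  define k where "k = nat (round (real m * x))"
  have k0: "round (real m * x) \<ge> 0"
  proof -
    have "round (0::real) \<le> round (real m * x)" using x by (intro round_mono) auto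
    then show ?thesis by simp
  qed
  \<comment> \<open>The value k = m does occur: near x = 1 the nearest root is 1 again, so the sum
    counts that root at both ends of the parameter interval.\<close>
  have km: "k \<le> m"
  proof -
    have "round (real m * x) \<le> round (real m)" using x by (intro round_mono) (simp add: mult_left_le)
    then show ?thesis by (simp add: k_def)
  qed
  have rk: "real k = of_int (round (real m * x))" using k0 by (simp add: k_def)
  \<comment> \<open>The argument of v ^ m, brought into [- pi, pi] by removing k full turns.\<close>
  define \<phi> where "\<phi> = 2 * pi * (real m * x - real k)"
  have d: "\<bar>real m * x - real k\<bar> \<le> 1 / 2"
    unfolding rk using of_int_round_abs_le[of "real m * x"] by (simp add: abs_minus_commute)
  have \<phi>: "\<bar>\<phi>\<bar> \<le> pi" using d by (simp add: \<phi>_def abs_mult)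
  have "v ^ m = of_real (r ^ m) * cis (real m * (2 * pi * x))"
    unfolding v_def power_mult_distrib by (simp add: cis_conv_exp exp_of_nat_mult[symmetric] mult_ac)
  also have "real m * (2 * pi * x) = \<phi> + 2 * pi * real k" by (simp add: \<phi>_def algebra_simps)
  also have "cis (\<phi> + 2 * pi * real k) = cis \<phi>"
    by (simp add: cis_mult[symmetric] cis_multiple_2pi)
  finally have v: "v ^ m = of_real (r ^ m) * cis \<phi>" .
  have rm: "r ^ m \<le> r" "0 \<le> r ^ m" "r ^ m \<le> 1"
    using r power_decreasing[of 1 m r] m by (auto intro: power_le_one)
  have "norm (1 - v ^ m) \<ge> ((1 - r ^ m) + \<bar>\<phi>\<bar> / pi) / 2"
    unfolding v by (rule norm_one_minus_rcis_ge[OF \<phi> rm(2,3)])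
  moreover have "\<bar>\<phi>\<bar> / pi \<ge> \<bar>x - real k / real m\<bar>"
  proof -
    have "\<bar>\<phi>\<bar> / pi = 2 * real m * \<bar>x - real k / real m\<bar>"
    proof -
      have "\<phi> = 2 * pi * real m * (x - real k / real m)" using m by (simp add: \<phi>_def field_simps)
      then show ?thesis by (simp add: abs_mult)
    qed
    moreover have "1 * \<bar>x - real k / real m\<bar> \<le> 2 * real m * \<bar>x - real k / real m\<bar>"
      using m by (intro mult_right_mono) auto
    ultimately show ?thesis by simp
  qed
  ultimately have ge: "norm (1 - v ^ m) \<ge> ((1 - r) + \<bar>x - real k / real m\<bar>) / 2"
    using rm(1) by simp
  have "norm (1 - v ^ m) powr (- b) \<le> (((1 - r) + \<bar>x - real k / real m\<bar>) / 2) powr (- b)"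
    using r b by (intro powr_mono2' ge) auto
  also have "\<dots> = 2 powr b * ((1 - r) + \<bar>x - real k / real m\<bar>) powr (- b)"
    using r by (simp add: powr_divide powr_minus_divide)
  also have "\<dots> \<le> 2 powr b * (\<Sum>k\<le>m. ((1 - r) + \<bar>x - real k / real m\<bar>) powr (- b))"
    using km by (intro mult_left_mono member_le_sum) auto
  finally show ?thesis .
qed

lemma taylor_coefficient_bound_powr:
  fixes H :: "complex \<Rightarrow> complex"
  assumes m: "m \<ge> 1" and hol: "H holomorphic_on ball 0 1" and b: "b > 1" and C: "C \<ge> 0"
    and bound: "\<And>v. 0 < norm v \<Longrightarrow> norm v < 1 \<Longrightarrow> norm (H v) \<le> C * norm (1 - v ^ m) powr (- b)"
  obtains K where "\<And>n. norm ((deriv ^^ n) H 0 / fact n) \<le> K * (real n + 2) powr (b - 1)"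
proof
  fix n
  \<comment> \<open>On this radius 1 / r ^ n stays below exp 1 while 1 - r is of order 1 / n; the 2
    keeps r positive for n = 0.\<close>
  define r where "r = 1 - 1 / (real n + 2)"
  have r: "0 < r" "r < 1" by (auto simp: r_def)
  have r': "1 - r = 1 / (real n + 2)" by (simp add: r_def)
  define p where "p = (\<lambda>x::real. of_real r * exp (2 * of_real pi * \<i> * of_real x))"
  define D where "D = (deriv ^^ n) H 0 / fact n"
  let ?s = "\<lambda>x. \<Sum>k\<le>m. ((1 - r) + \<bar>x - real k / real m\<bar>) powr (- b)"
  let ?G = "\<lambda>x. 2 * pi / r ^ n * (C * (2 powr b * ?s x))"
  have "cball 0 r \<subseteq> ball (0::complex) 1" using r by auto
  then have "H holomorphic_on cball 0 r" by (rule holomorphic_on_subset[OF hol])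
  then have "continuous_on (cball 0 r) H" "H holomorphic_on ball 0 r"
    by (auto intro: holomorphic_on_imp_continuous_on elim: holomorphic_on_subset)
  then have "((\<lambda>u. H u / (u - 0) ^ Suc n) has_contour_integral (2 * pi * \<i>) / fact n * (deriv ^^ n) H 0) (circlepath 0 r)"
    by (rule Cauchy_has_contour_integral_higher_derivative_circlepath) (use r in auto)
  then have I: "((\<lambda>x. H (p x) / p x ^ Suc n * (2 * of_real pi * \<i> * p x)) has_integral 2 * pi * \<i> * D) {0..1}"
    unfolding has_contour_integral_def
  proof (rule has_integral_eq[rotated, THEN has_integral_eq_rhs])
    fix x :: real assume x: "x \<in> {0..1}"
    have "vector_derivative (circlepath 0 r) (at x within {0..1}) = 2 * of_real pi * \<i> * p x"
      using x by (simp add: vector_derivative_circlepath01 p_def)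
    moreover have "circlepath 0 r x = p x" by (simp add: circlepath p_def)
    ultimately show "H (circlepath 0 r x) / (circlepath 0 r x - 0) ^ Suc n *
        vector_derivative (circlepath 0 r) (at x within {0..1}) =
        H (p x) / p x ^ Suc n * (2 * of_real pi * \<i> * p x)"
      by (simp only: diff_zero)
  qed (simp add: D_def)
  have pn: "norm (p x) = r" for x using r by (simp add: p_def norm_mult)
  have bd: "norm (H (p x) / p x ^ Suc n * (2 * of_real pi * \<i> * p x)) \<le> ?G x" if x: "x \<in> {0..1}" for x
  proof -
    have "norm (H (p x) / p x ^ Suc n * (2 * of_real pi * \<i> * p x)) = 2 * pi / r ^ n * norm (H (p x))"
      using r pn[of x] by (auto simp: norm_mult norm_divide norm_power divide_simps)
    also have "\<dots> \<le> 2 * pi / r ^ n * (C * norm (1 - p x ^ m) powr (- b))"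
      using r by (intro mult_left_mono bound) (auto simp: pn)
    also have "\<dots> \<le> ?G x"
      unfolding p_def using r b C x m
      by (intro mult_left_mono norm_one_minus_power_powr_le) auto
    finally show ?thesis .
  qed
  have km: "real k / real m \<le> 1" if "k \<in> {..m}" for k using that m by auto
  have inti: "(\<lambda>x. ((1 - r) + \<bar>x - real k / real m\<bar>) powr (- b)) integrable_on {0..1}" if "k \<in> {..m}" for k
    using r b km[OF that] by (intro integral_shifted_abs_powr_le) auto
  have sint: "?s integrable_on {0..1}" by (intro integrable_sum inti) auto
  have "2 * pi * norm D = norm (2 * pi * \<i> * D)" by (simp add: norm_mult)
  also have "\<dots> \<le> integral {0..1} ?G"
    unfolding integral_unique[OF I, symmetric]
  proof (rule integral_norm_bound_integral)
    show "(\<lambda>x. H (p x) / p x ^ Suc n * (2 * of_real pi * \<i> * p x)) integrable_on {0..1}"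
      using I by blast
    show "?G integrable_on {0..1}" by (intro integrable_on_mult_right sint)
  qed (rule bd)
  also have "\<dots> = 2 * pi / r ^ n * (C * (2 powr b * integral {0..1} ?s))"
    by simp
  also have "integral {0..1} ?s = (\<Sum>k\<le>m. integral {0..1} (\<lambda>x. ((1 - r) + \<bar>x - real k / real m\<bar>) powr (- b)))"
    by (intro integral_sum inti) auto
  also have "2 * pi / r ^ n * (C * (2 powr b * \<dots>)) \<le> 2 * pi / r ^ n * (C * (2 powr b * (\<Sum>k\<le>m. 2 * (1 - r) powr (1 - b) / (b - 1))))"
    using r b C km by (intro mult_left_mono sum_mono integral_shifted_abs_powr_le) auto
  also have "\<dots> = 2 * pi * ((1 / r ^ n) * (C * 2 powr b * (real m + 1) * 2 / (b - 1) * (real n + 2) powr (b - 1)))"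
  proof -
    have "(1 - r) powr (1 - b) = (real n + 2) powr (b - 1)"
      unfolding r' by (simp add: powr_divide powr_minus_divide[symmetric])
    then show ?thesis by (simp add: field_simps)
  qed
  finally have "2 * pi * norm D \<le> 2 * pi * ((1 / r ^ n) * (C * 2 powr b * (real m + 1) * 2 / (b - 1) * (real n + 2) powr (b - 1)))"
    .
  then have "norm D \<le> (1 / r ^ n) * (C * 2 powr b * (real m + 1) * 2 / (b - 1) * (real n + 2) powr (b - 1))"
    by (subst (asm) mult_le_cancel_left_pos) auto
  also have "\<dots> \<le> exp 1 * (C * 2 powr b * (real m + 1) * 2 / (b - 1) * (real n + 2) powr (b - 1))"
  proof (rule mult_right_mono)
    have "1 / r = 1 + 1 / (real n + 1)" by (simp add: r_def field_simps)
    then have "1 / r ^ n = (1 + 1 / (real n + 1)) ^ n" by (metis power_one_over)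
    also have "\<dots> \<le> exp (1 / (real n + 1)) ^ n"
      by (intro power_mono exp_ge_add_one_self) auto
    also have "\<dots> = exp (real n * (1 / (real n + 1)))" by (simp only: exp_of_nat_mult)
    also have "\<dots> \<le> exp 1" by simp
    finally show "1 / r ^ n \<le> exp 1" .
  qed (use C b in auto)
  finally show "norm ((deriv ^^ n) H 0 / fact n) \<le> (exp 1 * (C * 2 powr b * (real m + 1) * 2 / (b - 1))) * (real n + 2) powr (b - 1)"
    by (simp add: D_def mult.assoc)
qed

subsection \<open>The Borel transform on the unit disc\<close>

lemma fps_nth_compose_fps_X_power:
  fixes f :: "complex fps"
  assumes "m \<ge> 1"
  shows "fps_nth (f oo fps_X ^ m) k = (if m dvd k then fps_nth f (k div m) else 0)"
proof -
  have "fps_nth (f oo fps_X ^ m) k = (\<Sum>j=0..k. if k = m * j then fps_nth f j else 0)"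
    by (simp add: fps_compose_nth power_mult[symmetric] fps_X_power_nth if_distrib cong: if_cong)
  also have "\<dots> = (\<Sum>j\<in>{0..k}. if j = k div m then (if m dvd k then fps_nth f j else 0) else 0)"
    using assms by (intro sum.cong) auto
  also have "\<dots> = (if m dvd k then fps_nth f (k div m) else 0)"
    by simp
  finally show ?thesis .
qed

text \<open>F ^ i with i > n does not reach the coefficient at n because F has no constant term; a
  common finite range for i then permits exchanging the sums.\<close>

lemma fps_nth_mult_compose:
  fixes Q P F :: "complex fps"
  assumes "fps_nth F 0 = 0"
  shows "fps_nth (Q * (P oo F)) n = (\<Sum>i\<le>n. fps_nth P i * fps_nth (Q * F ^ i) n)"
proof -
  have comp: "fps_nth (P oo F) k = (\<Sum>i\<le>n. fps_nth P i * fps_nth (F ^ i) k)" if "k \<le> n" for k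
    unfolding fps_compose_nth
    by (rule sum.mono_neutral_left) (use that assms in \<open>auto intro: startsby_zero_power_prefix[rule_format]\<close>)
  have "fps_nth (Q * (P oo F)) n = fps_nth ((P oo F) * Q) n" by (simp add: mult.commute)
  also have "\<dots> = (\<Sum>k\<le>n. (\<Sum>i\<le>n. fps_nth P i * fps_nth (F ^ i) k) * fps_nth Q (n - k))"
    unfolding fps_mult_nth atLeast0AtMost by (rule sum.cong) (auto simp: comp)
  also have "\<dots> = (\<Sum>i\<le>n. fps_nth P i * (\<Sum>k\<le>n. fps_nth (F ^ i) k * fps_nth Q (n - k)))"
    unfolding sum_distrib_left sum_distrib_right by (subst sum.swap) (simp add: mult_ac)
  also have "\<dots> = (\<Sum>i\<le>n. fps_nth P i * fps_nth (Q * F ^ i) n)"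
    by (subst (2) mult.commute) (simp add: fps_mult_nth atLeast0AtMost)
  finally show ?thesis .
qed

text \<open>Here g is the Borel transform in the coordinate w = log zeta. The period encodes the m
  sheets, and \<open>ext\<close> ties g near zeta = 0 to the series with coefficients a.\<close>

locale borel_disc =
  fixes m :: nat and a :: "nat \<Rightarrow> complex" and lam :: real and g :: "complex \<Rightarrow> complex"
  assumes m: "m \<ge> 1" and lam: "lam > 0"
    and hol: "g holomorphic_on Omega_log lam"
    and per: "w \<in> Omega_log lam \<Longrightarrow> g (w + 2 * pi * \<i> * of_nat m) = g w"
    and ext: "\<exists>\<rho>>0. \<forall>w. Re w < ln \<rho> \<longrightarrow> w \<in> Omega_log lam \<and> borel_term m a w sums g w"
begin

text \<open>With \<open>u = v ^ m\<close>, \<open>log_map v\<close> is a logarithm of \<open>\<zeta> = - lam * Ln (1 - u)\<close> and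
  \<open>root_map v\<close> is the corresponding value of \<open>\<zeta> powr (1 / m)\<close>. The value of \<open>disc_fun\<close> at 0
  is the one that removes its singularity there.\<close>

definition ell :: "complex \<Rightarrow> complex" where
  "ell v = of_real (ln lam) + Ln (log_quot (v ^ m))"

definition log_map :: "complex \<Rightarrow> complex" where
  "log_map v = of_nat m * Ln v + ell v"

definition root_map :: "complex \<Rightarrow> complex" where
  "root_map v = v * exp (ell v / of_nat m)"

text \<open>Since zeta = v ^ m * exp (ell v), this is v ^ (m - 1) / zeta powr (1 - 1 / m) with its
  apparent singularity at v = 0 removed.\<close>

definition weight :: "complex \<Rightarrow> complex" where
  "weight v = exp ((1 / of_nat m - 1) * ell v)"

text \<open>The power series in zeta powr (1 / m) of g times zeta powr (1 - 1 / m); the index shift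
  is there because the Borel series starts at n = 1.\<close>

definition borel_fps :: "complex fps" where
  "borel_fps = Abs_fps (\<lambda>i. a (Suc i) * of_real (rGamma (real (Suc i) / real m)))"

definition disc_fun :: "complex \<Rightarrow> complex" where
  "disc_fun v = (if v = 0 then weight 0 * fps_nth borel_fps 0 else g (log_map v) * v ^ (m - 1))"

section \<open>Holomorphy away from the centre of the disc\<close>

lemma norm_power_less_1: "norm v < 1 \<Longrightarrow> norm (v ^ m) < (1::real)" for v :: complex
  using m power_decreasing[of 1 m "norm v"] by (simp add: norm_power)

lemma exp_ell: "norm v < 1 \<Longrightarrow> exp (ell v) = of_real lam * log_quot (v ^ m)"
  using log_quot_nonzero norm_power_less_1 lam by (simp add: ell_def exp_add exp_of_real)

lemma ell_holomorphic: "ell holomorphic_on ball 0 1"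
proof -
  have "(log_quot \<circ> (\<lambda>v. v ^ m)) holomorphic_on ball 0 1"
    by (rule holomorphic_on_compose_gen[OF _ log_quot_holomorphic])
       (use norm_power_less_1 in \<open>auto intro!: holomorphic_intros\<close>)
  then show ?thesis unfolding ell_def
    by (intro holomorphic_intros) (use log_quot_not_nonpos norm_power_less_1 in \<open>auto simp: o_def\<close>)
qed

text \<open>Stated for an arbitrary logarithm w of zeta, so that it serves both branches used to
  cover the punctured disc.\<close>

lemma Omega_log_I:
  assumes "0 < norm v" "norm v < 1" "exp w = v ^ m * exp (ell v)"
  shows "w \<in> Omega_log lam"
proof -
  have u: "norm (v ^ m) < 1" "v ^ m \<noteq> 0" using assms norm_power_less_1 by auto
  have eq: "exp w = of_real lam * (- Ln (1 - v ^ m))"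
    unfolding assms(3) exp_ell[OF assms(2)] using u(2) by (simp add: log_quot_def del: power_eq_0_iff)
  have "- Ln (1 - v ^ m) \<in> Delta"
    unfolding Delta_def using u by (intro imageI) (simp add: dist_norm)
  then have "exp w \<in> Delta_lam_star lam"
    unfolding Delta_lam_star_def by (metis DiffI eq exp_not_eq_zero imageI singletonD)
  then show ?thesis by (simp add: Omega_log_def)
qed

lemma exp_log_map: "v \<noteq> 0 \<Longrightarrow> exp (log_map v) = v ^ m * exp (ell v)"
  by (simp add: log_map_def exp_add exp_of_nat_mult)

lemma log_map_in_Omega: "0 < norm v \<Longrightarrow> norm v < 1 \<Longrightarrow> log_map v \<in> Omega_log lam"
  by (rule Omega_log_I) (auto simp: exp_log_map)

lemma disc_fun_holomorphic_punctured: "disc_fun holomorphic_on ball 0 1 - {0}"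
proof -
  \<comment> \<open>The branch of the logarithm used off the positive axis differs from \<open>Ln\<close> by \<open>0\<close> or \<open>2 * pi * \<i>\<close>, which
    \<open>log_map\<close> multiplies by \<open>m\<close>: this is the period of \<open>g\<close>.\<close>
  let ?A = "ball 0 1 - \<real>\<^sub>\<le>\<^sub>0 :: complex set" and ?B = "ball 0 1 - \<real>\<^sub>\<ge>\<^sub>0 :: complex set"
  define log_map' where "log_map' = (\<lambda>v. of_nat m * (Ln (- v) + of_real pi * \<i>) + ell v)"
  have ell: "ell holomorphic_on ?A" "ell holomorphic_on ?B"
    by (auto intro: holomorphic_on_subset[OF ell_holomorphic])
  have "disc_fun holomorphic_on ?A"
  proof -
    have h: "log_map holomorphic_on ?A"
      unfolding log_map_def by (intro holomorphic_intros ell) auto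
    have im: "log_map ` ?A \<subseteq> Omega_log lam"
    proof safe
      fix v :: complex assume "v \<in> ball 0 1" "v \<notin> \<real>\<^sub>\<le>\<^sub>0"
      moreover from this have "v \<noteq> 0" by auto
      ultimately show "log_map v \<in> Omega_log lam" by (simp add: log_map_in_Omega)
    qed
    have "(\<lambda>v. (g \<circ> log_map) v * v ^ (m - 1)) holomorphic_on ?A"
      by (intro holomorphic_intros holomorphic_on_compose_gen[OF h hol] im)
    then show ?thesis
      by (rule holomorphic_transform) (auto simp: disc_fun_def)
  qed
  moreover have "disc_fun holomorphic_on ?B"
  proof -
    have h: "log_map' holomorphic_on ?B"
      unfolding log_map'_def by (intro holomorphic_intros ell) (auto simp: complex_nonpos_Reals_iff complex_nonneg_Reals_iff)
    have cases: "log_map' v = log_map v \<or> log_map' v = log_map v + 2 * pi * \<i> * of_nat m" if "v \<noteq> 0" for v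
      using Ln_minus[OF that] by (auto simp: log_map'_def log_map_def algebra_simps)
    have im: "log_map' ` ?B \<subseteq> Omega_log lam"
    proof safe
      fix v :: complex assume v: "v \<in> ball 0 1" "v \<notin> \<real>\<^sub>\<ge>\<^sub>0"
      then have v0: "v \<noteq> 0" by auto
      have "exp (log_map' v) = (exp (Ln (- v)) * exp (of_real pi * \<i>)) ^ m * exp (ell v)"
        by (simp only: log_map'_def exp_add exp_of_nat_mult)
      also have "\<dots> = v ^ m * exp (ell v)" using v0 by simp
      finally show "log_map' v \<in> Omega_log lam"
        using v v0 by (intro Omega_log_I[of v]) auto
    qed
    have "(\<lambda>v. (g \<circ> log_map') v * v ^ (m - 1)) holomorphic_on ?B"
      by (intro holomorphic_intros holomorphic_on_compose_gen[OF h hol] im)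
    moreover have "(g \<circ> log_map') v * v ^ (m - 1) = disc_fun v" if "v \<in> ?B" for v
    proof -
      have v0: "v \<noteq> 0" using that by auto
      then have "g (log_map' v) = g (log_map v)"
        using cases[OF v0] per[OF log_map_in_Omega[of v]] that by auto
      then show ?thesis using v0 by (simp add: disc_fun_def)
    qed
    ultimately show ?thesis by (rule holomorphic_transform)
  qed
  ultimately have "disc_fun holomorphic_on (?A \<union> ?B)"
    by (intro holomorphic_on_Un) (auto intro!: open_Diff)
  moreover have "?A \<union> ?B = ball 0 1 - {0}"
    by (auto simp: complex_nonpos_Reals_iff complex_nonneg_Reals_iff complex_eq_iff)
  ultimately show ?thesis by simp
qed

section \<open>Expansion at the centre and identification of the coefficients\<close>

lemma borel_fps_sums:
  obtains \<rho> where "\<rho> > 0"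
    "\<And>w. Re w < ln \<rho> \<Longrightarrow> (\<lambda>i. fps_nth borel_fps i * exp (w / of_nat m) ^ i) sums (g w * exp ((1 - 1 / of_nat m) * w))"
proof -
  obtain \<rho> where \<rho>: "\<rho> > 0" "\<And>w. Re w < ln \<rho> \<Longrightarrow> borel_term m a w sums g w"
    using ext by auto
  show ?thesis
  proof (rule that[OF \<rho>(1)])
    fix w assume "Re w < ln \<rho>"
    from \<rho>(2)[OF this] have "(\<lambda>i. borel_term m a w (Suc i)) sums g w"
      by (subst sums_Suc_iff) (simp add: borel_term_def)
    then have "(\<lambda>i. borel_term m a w (Suc i) * exp ((1 - 1 / of_nat m) * w)) sums (g w * exp ((1 - 1 / of_nat m) * w))"
      by (rule sums_mult2)
    \<comment> \<open>The exponents (i + 1) / m - 1 and 1 - 1 / m add up to i / m, an integer power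
      of zeta powr (1 / m).\<close>
    moreover have "borel_term m a w (Suc i) * exp ((1 - 1 / of_nat m) * w) = fps_nth borel_fps i * exp (w / of_nat m) ^ i" for i
    proof -
      have "exp (complex_of_real (real (Suc i) / real m - 1) * w) * exp ((1 - 1 / of_nat m) * w) = exp (w / of_nat m) ^ i"
        using m unfolding exp_add[symmetric] exp_of_nat_mult[symmetric]
        by (intro arg_cong[where f = exp]) (simp add: field_simps)
      then show ?thesis by (simp add: borel_term_def borel_fps_def mult_ac)
    qed
    ultimately show "(\<lambda>i. fps_nth borel_fps i * exp (w / of_nat m) ^ i) sums (g w * exp ((1 - 1 / of_nat m) * w))"
      by simp
  qed
qed

lemma borel_fps_conv_radius: "fps_conv_radius borel_fps > 0"
proof -
  obtain \<rho> where \<rho>: "\<rho> > 0"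
    "\<And>w. Re w < ln \<rho> \<Longrightarrow> (\<lambda>i. fps_nth borel_fps i * exp (w / of_nat m) ^ i) sums (g w * exp ((1 - 1 / of_nat m) * w))"
    using borel_fps_sums by blast
  \<comment> \<open>Any w in the half plane of convergence would do: one nonzero point of
    convergence bounds the radius from below.\<close>
  define w where "w = complex_of_real (ln \<rho> - 1)"
  have "summable (\<lambda>i. fps_nth borel_fps i * exp (w / of_nat m) ^ i)"
    using \<rho>(2)[of w] by (auto simp: w_def summable_def)
  then have "conv_radius (fps_nth borel_fps) \<ge> norm (exp (w / of_nat m))"
    by (rule conv_radius_geI)
  moreover have "ereal (norm (exp (w / of_nat m))) > 0" by simp
  ultimately show ?thesis unfolding fps_conv_radius_def by (meson less_le_trans)
qed

lemma
  shows root_map_holomorphic: "root_map holomorphic_on ball 0 1"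
    and weight_holomorphic: "weight holomorphic_on ball 0 1"
  unfolding root_map_def weight_def using m by (auto intro!: holomorphic_intros ell_holomorphic)

lemma root_map_has_fps: "root_map has_fps_expansion fps_expansion root_map 0"
  by (rule has_fps_expansion_fps_expansion[OF _ _ root_map_holomorphic]) auto

lemma weight_has_fps: "weight has_fps_expansion fps_expansion weight 0"
  by (rule has_fps_expansion_fps_expansion[OF _ _ weight_holomorphic]) auto

lemma root_map_fps_0: "fps_nth (fps_expansion root_map 0) 0 = 0"
  by (simp add: fps_expansion_def root_map_def)

definition disc_fps :: "complex fps" where
  "disc_fps = fps_expansion weight 0 * (borel_fps oo fps_expansion root_map 0)"

text \<open>As v tends to 0 so does zeta, hence the Borel series is available near the centre; in
  this form \<open>disc_fun\<close> is built from power series in v, also at v = 0.\<close>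

lemma disc_fun_eventually:
  "\<forall>\<^sub>F v in nhds 0. disc_fun v = weight v * eval_fps borel_fps (root_map v)"
proof -
  obtain \<rho> where \<rho>: "\<rho> > 0"
    "\<And>w. Re w < ln \<rho> \<Longrightarrow> (\<lambda>i. fps_nth borel_fps i * exp (w / of_nat m) ^ i) sums (g w * exp ((1 - 1 / of_nat m) * w))"
    using borel_fps_sums by blast
  have "isCont (\<lambda>v. v ^ m * exp (ell v)) 0"
  proof -
    have "continuous_on (ball 0 1) ell" by (rule holomorphic_on_imp_continuous_on[OF ell_holomorphic])
    then have "isCont ell 0" by (simp add: continuous_on_eq_continuous_at)
    then show ?thesis by (intro continuous_intros)
  qed
  then have "((\<lambda>v. v ^ m * exp (ell v)) \<longlongrightarrow> 0 ^ m * exp (ell 0)) (nhds 0)"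
    by (simp add: continuous_at tendsto_nhds_iff)
  then have "((\<lambda>v. norm (v ^ m * exp (ell v))) \<longlongrightarrow> 0) (nhds 0)"
    using m tendsto_norm_zero[of "\<lambda>v. v ^ m * exp (ell v)"] by (simp add: power_0_left del: norm_mult)
  then have "\<forall>\<^sub>F v in nhds 0. norm (v ^ m * exp (ell v)) < \<rho>"
    using \<rho>(1) by (rule order_tendstoD(2))
  then show ?thesis
  proof eventually_elim
    case (elim v)
    show ?case
    proof (cases "v = 0")
      case True
      then show ?thesis by (simp add: disc_fun_def root_map_def eval_fps_at_0)
    next
      case False
      have "exp (Re (log_map v)) < \<rho>" using elim exp_log_map[OF False] by (metis norm_exp_eq_Re)
      then have re: "Re (log_map v) < ln \<rho>" using \<rho>(1) by (metis exp_less_cancel_iff exp_ln)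
      \<comment> \<open>\<open>log_map v\<close> contains m times \<open>Ln v\<close>, so dividing
        by m gives back v itself and no m-th root has to be chosen.\<close>
      have root: "exp (log_map v / of_nat m) = root_map v"
        using False m by (simp add: log_map_def root_map_def add_divide_distrib exp_add)
      have "eval_fps borel_fps (root_map v) = g (log_map v) * exp ((1 - 1 / of_nat m) * log_map v)"
        using sums_unique[OF \<rho>(2)[OF re]] by (simp add: eval_fps_def root)
      also have "(1 - 1 / of_nat m) * log_map v = of_nat (m - 1) * Ln v - (1 / of_nat m - 1) * ell v"
        using m by (simp add: log_map_def of_nat_diff field_simps)
      also have "exp \<dots> = v ^ (m - 1) / weight v"
        using False by (simp add: exp_diff exp_of_nat_mult weight_def)
      finally show ?thesis using False by (simp add: disc_fun_def weight_def)
    qed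
  qed
qed

lemma disc_fun_has_fps: "disc_fun has_fps_expansion disc_fps"
proof -
  have "(eval_fps borel_fps \<circ> root_map) has_fps_expansion (borel_fps oo fps_expansion root_map 0)"
    by (intro has_fps_expansion_compose eval_fps_has_fps_expansion borel_fps_conv_radius root_map_has_fps root_map_fps_0)
  then have "(\<lambda>v. weight v * (eval_fps borel_fps \<circ> root_map) v) has_fps_expansion disc_fps"
    unfolding disc_fps_def by (intro has_fps_expansion_mult weight_has_fps)
  then show ?thesis
    using disc_fun_eventually by (subst has_fps_expansion_cong[OF _ refl]) (auto elim: eventually_mono)
qed

text \<open>The expansion at 0 makes the function holomorphic near the centre; the rest is gluing
  with the punctured disc.\<close>

lemma disc_fun_holomorphic: "disc_fun holomorphic_on ball 0 1"
proof -
  obtain S where S: "open S" "0 \<in> S" "disc_fun holomorphic_on S"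
    using has_fps_expansion_imp_analytic_0[OF disc_fun_has_fps] unfolding analytic_at by blast
  then have "disc_fun holomorphic_on (S \<union> (ball 0 1 - {0}))"
    by (intro holomorphic_on_Un disc_fun_holomorphic_punctured) auto
  then show ?thesis by (rule holomorphic_on_subset) (use S in auto)
qed

text \<open>The two maps combine to exp (c * ell v) * v ^ i, and c is r - 1 for r = (i + 1) / m: the
  binomial exponent occurring in \<open>dlam_conv_fps\<close>.\<close>

lemma weight_root_map_fps:
  fixes i :: nat
  defines "c \<equiv> real (Suc i) / real m - 1"
  shows "fps_expansion weight 0 * fps_expansion root_map 0 ^ i =
     fps_const (of_real (lam powr c)) * ((fps_binomial (of_real c) oo log_quot_tail) oo fps_X ^ m) * fps_X ^ i"
proof (rule fps_expansion_unique_complex)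
  show "(\<lambda>v. weight v * root_map v ^ i) has_fps_expansion fps_expansion weight 0 * fps_expansion root_map 0 ^ i"
    by (intro has_fps_expansion_mult has_fps_expansion_power weight_has_fps root_map_has_fps)
  have comp: "((\<lambda>u. log_quot u powr of_real c) \<circ> (\<lambda>v. v ^ m)) has_fps_expansion ((fps_binomial (of_real c) oo log_quot_tail) oo fps_X ^ m)"
    using m by (intro has_fps_expansion_compose log_quot_powr_has_fps_expansion has_fps_expansion_fps_X_power)
      (simp add: fps_X_power_nth)
  have *: "(\<lambda>v. of_real (lam powr c) * ((\<lambda>u. log_quot u powr of_real c) \<circ> (\<lambda>v. v ^ m)) v * v ^ i) has_fps_expansion
    fps_const (of_real (lam powr c)) * ((fps_binomial (of_real c) oo log_quot_tail) oo fps_X ^ m) * fps_X ^ i"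
    by (intro has_fps_expansion_mult has_fps_expansion_const comp has_fps_expansion_fps_X_power)
  have "weight v * root_map v ^ i = of_real (lam powr c) * ((\<lambda>u. log_quot u powr of_real c) \<circ> (\<lambda>v. v ^ m)) v * v ^ i"
    if v: "norm v < 1" for v
  proof -
    have "weight v * root_map v ^ i = exp (of_real c * ell v) * v ^ i"
    proof -
      have "exp ((1 / of_nat m - 1) * ell v) * exp (ell v / of_nat m) ^ i = exp (of_real c * ell v)"
        using m unfolding exp_add[symmetric] exp_of_nat_mult[symmetric]
        by (intro arg_cong[where f = exp]) (simp add: c_def field_simps)
      then show ?thesis by (simp add: weight_def root_map_def power_mult_distrib mult_ac)
    qed
    also have "exp (of_real c * ell v) = of_real (lam powr c) * log_quot (v ^ m) powr of_real c"
      using log_quot_nonzero[OF norm_power_less_1[OF v]] lam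
      by (simp add: ell_def distrib_left exp_add powr_def exp_of_real[symmetric] mult_ac)
    finally show ?thesis by simp
  qed
  then have "\<forall>\<^sub>F v in nhds 0. weight v * root_map v ^ i = of_real (lam powr c) * ((\<lambda>u. log_quot u powr of_real c) \<circ> (\<lambda>v. v ^ m)) v * v ^ i"
    by (intro eventually_nhds_in_open[THEN eventually_mono, of "ball 0 1"]) auto
  with * show "(\<lambda>v. weight v * root_map v ^ i) has_fps_expansion
    fps_const (of_real (lam powr c)) * ((fps_binomial (of_real c) oo log_quot_tail) oo fps_X ^ m) * fps_X ^ i"
    by (subst has_fps_expansion_cong[OF _ refl])
qed

text \<open>Each summand is a series in v ^ m times v ^ i, so the coefficient at n collects the i
  with n - i = j * m; putting i = n - j * m gives the convolution for index n + 1.\<close>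

lemma disc_fps_nth: "fps_nth disc_fps n = dlam m lam a (Suc n)"
proof -
  let ?c = "\<lambda>i. real (Suc i) / real m - 1"
  let ?t = "\<lambda>i j. fps_nth borel_fps i * (of_real (lam powr ?c i) * fps_nth (fps_binomial (of_real (?c i)) oo log_quot_tail) j)"
  have "fps_nth disc_fps n = (\<Sum>i\<le>n. fps_nth borel_fps i * fps_nth (fps_expansion weight 0 * fps_expansion root_map 0 ^ i) n)"
    unfolding disc_fps_def by (rule fps_nth_mult_compose[OF root_map_fps_0])
  also have "\<dots> = (\<Sum>i\<le>n. if m dvd n - i then ?t i ((n - i) div m) else 0)"
    unfolding weight_root_map_fps
    by (rule sum.cong) (auto simp: fps_X_power_mult_right_nth fps_nth_compose_fps_X_power[OF m] simp del: of_nat_Suc)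
  also have "\<dots> = (\<Sum>i | i \<le> n \<and> m dvd n - i. ?t i ((n - i) div m))"
    by (subst sum.inter_filter[symmetric]) (auto intro!: sum.cong)
  also have "\<dots> = (\<Sum>j | j * m < Suc n. ?t (n - j * m) j)"
    by (rule sum.reindex_bij_witness[of _ "\<lambda>j. n - j * m" "\<lambda>i. (n - i) div m"]) (use m in auto)
  also have "\<dots> = dlam m lam a (Suc n)"
    unfolding dlam_conv_fps[OF m le_add1[of 1 n, unfolded plus_1_eq_Suc]]
  proof (rule sum.cong[OF refl])
    fix j assume "j \<in> {j. j * m < Suc n}"
    then have "Suc n - j * m = Suc (n - j * m)" by auto
    then show "?t (n - j * m) j = complex_of_real (rGamma (real (Suc n - j * m) / real m)) *
     alam m lam a (Suc n - j * m) *
     fps_nth (fps_binomial (complex_of_real (real (Suc n - j * m) / real m - 1)) oo log_quot_tail) j"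
      by (simp add: borel_fps_def alam_def mult_ac)
  qed
  finally show ?thesis .
qed

lemma disc_fun_sums:
  assumes "norm v < 1"
  shows "(\<lambda>n. dlam m lam a (Suc n) * v ^ n) sums disc_fun v"
  using holomorphic_power_series[OF disc_fun_holomorphic, of v] assms
  by (simp add: fps_nth_fps_expansion[OF disc_fun_has_fps, symmetric] disc_fps_nth)

section \<open>Growth towards the boundary of the disc\<close>

lemma disc_fun_bound:
  assumes A: "A \<ge> 0" and B: "B \<ge> 0"
    and bound: "\<And>w. w \<in> Omega_log lam \<Longrightarrow>
      norm (g w * exp (complex_of_real ((real m - 1) / real m) * w)) \<le> A * exp (B * norm (exp w))"
  obtains C where "C \<ge> 0"
    "\<And>v. 0 < norm v \<Longrightarrow> norm v < 1 \<Longrightarrow> norm (disc_fun v) \<le> C * norm (1 - v ^ m) powr (- (B * lam))"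
proof (rule that)
  \<comment> \<open>\<open>C1\<close> bounds |weight|: the exponent 1 / m - 1 is nonpositive, so a
    lower bound on |log_quot| is what is needed. \<open>C2\<close> is the price of trading exp (B *
    |zeta|) for a power of |1 - v ^ m|.\<close>
  define C1 where "C1 = (lam * exp (- 1)) powr (1 / real m - 1)"
  define C2 where "C2 = exp (B * lam * (2 * ln 2 + pi))"
  show "A * C2 * C1 \<ge> 0" using A by (simp add: C1_def C2_def)
  fix v :: complex assume v: "0 < norm v" "norm v < 1"
  have v0: "v \<noteq> 0" using v by auto
  have u: "norm (v ^ m) < 1" using norm_power_less_1 v by auto
  have u0: "v ^ m \<noteq> 0" using v0 by simp
  have "of_real ((real m - 1) / real m) * log_map v = of_nat (m - 1) * Ln v - (1 / of_nat m - 1) * ell v"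
    using m by (simp add: log_map_def of_nat_diff field_simps)
  then have "exp (of_real ((real m - 1) / real m) * log_map v) = v ^ (m - 1) / weight v"
    using v0 by (simp add: exp_diff exp_of_nat_mult weight_def)
  then have "disc_fun v = (g (log_map v) * exp (of_real ((real m - 1) / real m) * log_map v)) * weight v"
    using v0 by (simp add: disc_fun_def weight_def)
  then have "norm (disc_fun v) = norm (g (log_map v) * exp (of_real ((real m - 1) / real m) * log_map v)) * norm (weight v)"
    by (simp only: norm_mult)
  also have "\<dots> \<le> (A * C2 * norm (1 - v ^ m) powr (- (B * lam))) * C1"
  proof (rule mult_mono)
    have "exp (log_map v) = of_real lam * (v ^ m * log_quot (v ^ m))"
      using exp_log_map[OF v0] exp_ell[OF v(2)] by simp
    also have "v ^ m * log_quot (v ^ m) = - Ln (1 - v ^ m)"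
      using u0 by (simp add: log_quot_def del: power_eq_0_iff)
    finally have n: "norm (exp (log_map v)) = lam * norm (Ln (1 - v ^ m))"
      using lam by (simp add: norm_mult)
    have s: "1 - v ^ m \<noteq> 0" "norm (1 - v ^ m) < 2"
      using u norm_triangle_ineq4[of 1 "v ^ m"] by auto
    have "norm (g (log_map v) * exp (of_real ((real m - 1) / real m) * log_map v)) \<le> A * exp (B * lam * norm (Ln (1 - v ^ m)))"
      using bound[OF log_map_in_Omega[OF v]] by (simp only: n mult.assoc)
    also have "\<dots> \<le> A * (C2 * norm (1 - v ^ m) powr (- (B * lam)))"
      unfolding C2_def using A B lam s by (intro mult_left_mono exp_norm_Ln_le) auto
    finally show "norm (g (log_map v) * exp (of_real ((real m - 1) / real m) * log_map v)) \<le> A * C2 * norm (1 - v ^ m) powr (- (B * lam))"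
      by simp
    have "norm (weight v) = norm (exp (ell v)) powr (1 / real m - 1)"
    proof -
      have "Re ((1 / of_nat m - 1) * ell v) = (1 / real m - 1) * Re (ell v)"
      proof -
        have "(1 / of_nat m - 1) * ell v = of_real (1 / real m - 1) * ell v" by simp
        then show ?thesis by (simp only: Re_complex_of_real times_complex.sel Im_complex_of_real)
      qed
      then show ?thesis unfolding weight_def norm_exp_eq_Re by (simp add: powr_def)
    qed
    also have "norm (exp (ell v)) = lam * norm (log_quot (v ^ m))"
      using exp_ell[OF v(2)] lam by (simp add: norm_mult)
    also have "(lam * norm (log_quot (v ^ m))) powr (1 / real m - 1) \<le> C1"
      unfolding C1_def using norm_log_quot_ge[OF u] lam m
      by (intro powr_mono2') (auto simp: field_simps)
    finally show "norm (weight v) \<le> C1" .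
  qed (use A in \<open>auto simp: C1_def C2_def\<close>)
  finally show "norm (disc_fun v) \<le> A * C2 * C1 * norm (1 - v ^ m) powr (- (B * lam))"
    by (simp add: mult_ac)
qed

section \<open>Expansion along the positive ray\<close>

lemma disc_fun_of_real:
  assumes s: "s > 0"
  defines "u \<equiv> 1 - exp (- s / lam)"
  shows "disc_fun (of_real (u powr (1 / real m))) = g (of_real (ln s)) * of_real (u powr (1 / real m)) ^ (m - 1)"
proof -
  have u: "0 < u" "u < 1" using s lam by (auto simp: u_def)
  define v where "v = u powr (1 / real m)"
  have v: "0 < v" using u by (simp add: v_def)
  have vm: "v ^ m = u" using u m by (simp add: v_def powr_realpow[symmetric] powr_powr)
  have "Ln (1 - of_real u) = of_real (- s / lam)"
  proof -
    have "Ln (1 - of_real u) = Ln (of_real (exp (- s / lam)))" by (simp add: u_def)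
    also have "\<dots> = of_real (- s / lam)" by (subst Ln_of_real) auto
    finally show ?thesis .
  qed
  then have "log_quot (of_real v ^ m) = of_real (s / lam / u)"
    using u by (simp add: log_quot_def vm flip: of_real_power)
  then have "ell (of_real v) = of_real (ln lam) + of_real (ln (s / lam / u))"
    using s lam u unfolding ell_def by (simp add: Ln_of_real del: of_real_divide)
  moreover have "Ln (of_real v) = of_real (ln v)" using v by (rule Ln_of_real)
  \<comment> \<open>Only logarithms of positive reals enter, so \<open>log_map\<close> hits ln s
    itself, on the sheet arg zeta = 0.\<close>
  ultimately have "log_map (of_real v) = of_real (real m * ln v + (ln lam + ln (s / lam / u)))"
    unfolding log_map_def by (simp only: of_real_add of_real_mult of_real_of_nat_eq)
  also have "real m * ln v + (ln lam + ln (s / lam / u)) = ln s"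
    using s lam u m by (simp add: v_def ln_powr ln_div ln_mult)
  finally show ?thesis using v by (simp add: disc_fun_def v_def[symmetric])
qed

lemma borel_ray_sums:
  assumes s: "s > 0"
  defines "u \<equiv> 1 - exp (- s / lam)"
  shows "(\<lambda>n. dlam m lam a (Suc n) * of_real (u powr (real (Suc n) / real m - 1))) sums g (of_real (ln s))"
    and "summable (\<lambda>n. norm (dlam m lam a (Suc n) * of_real (u powr (real (Suc n) / real m - 1))))"
proof -
  have u: "0 < u" "u < 1" using s lam by (auto simp: u_def)
  define v where "v = u powr (1 / real m)"
  have v: "0 < v" "v < 1" using u m powr_less_mono2[of "1 / real m" u 1] by (simp_all add: v_def)
  \<comment> \<open>Dividing by v ^ (m - 1) undoes the factor built into
    \<open>disc_fun\<close>.\<close>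
  have pw: "u powr (real (Suc n) / real m - 1) = v ^ n / v ^ (m - 1)" for n
  proof -
    have "v ^ k = u powr (real k / real m)" for k
      using u by (simp add: v_def powr_realpow[symmetric] powr_powr)
    then have "v ^ n / v ^ (m - 1) = u powr (real n / real m - real (m - 1) / real m)"
      by (simp only: powr_diff)
    also have "real n / real m - real (m - 1) / real m = real (Suc n) / real m - 1"
      using m by (simp add: field_simps of_nat_diff)
    finally show ?thesis by simp
  qed
  have term_eq: "dlam m lam a (Suc n) * of_real (u powr (real (Suc n) / real m - 1)) =
      dlam m lam a (Suc n) * of_real v ^ n / of_real v ^ (m - 1)" for n
    unfolding pw by simp
  have "(\<lambda>n. dlam m lam a (Suc n) * of_real v ^ n) sums disc_fun (of_real v)"
    using v by (intro disc_fun_sums) auto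
  from sums_divide[OF this, of "of_real v ^ (m - 1)"]
  show "(\<lambda>n. dlam m lam a (Suc n) * of_real (u powr (real (Suc n) / real m - 1))) sums g (of_real (ln s))"
    unfolding term_eq using v disc_fun_of_real[OF s] by (simp add: v_def u_def)
  obtain r where r: "v < r" "r < 1" using v dense by blast
  have "summable (\<lambda>n. dlam m lam a (Suc n) * of_real r ^ n)"
    using disc_fun_sums[of "of_real r"] r v by (auto simp: summable_def)
  then have "summable (\<lambda>n. norm (dlam m lam a (Suc n) * of_real v ^ n))"
    by (rule powser_insidea) (use v r in auto)
  then have "summable (\<lambda>n. norm (dlam m lam a (Suc n) * of_real v ^ n) / v ^ (m - 1))"
    by (rule summable_divide)
  then show "summable (\<lambda>n. norm (dlam m lam a (Suc n) * of_real (u powr (real (Suc n) / real m - 1))))"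
    unfolding term_eq using v by (simp add: norm_divide norm_power)
qed

section \<open>Summability and termwise integration\<close>

lemma summable_dlam_Beta:
  assumes A: "A \<ge> 0" and B: "B > 0" and x: "x > max B (1 / lam)"
    and bound: "\<And>w. w \<in> Omega_log lam \<Longrightarrow>
      norm (g w * exp (complex_of_real ((real m - 1) / real m) * w)) \<le> A * exp (B * norm (exp w))"
  shows "summable (\<lambda>n. norm (dlam m lam a (Suc n)) * Beta (real (Suc n) / real m) (lam * x))"
proof -
  \<comment> \<open>B' \<ge> B keeps the growth bound valid, B' > 1 / lam gives b > 1 as the
    averaging requires, and B' < x makes the final exponent b - 1 - lam * x less than -1.\<close>
  obtain B' where B': "max B (1 / lam) < B'" "B' < x" using x dense by blast
  have B'0: "B' \<ge> 0" using B' B by simp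
  have bound': "norm (g w * exp (complex_of_real ((real m - 1) / real m) * w)) \<le> A * exp (B' * norm (exp w))"
    if "w \<in> Omega_log lam" for w
    using bound[OF that] B' A
    by (elim order_trans) (auto intro!: mult_left_mono mult_right_mono)
  define b where "b = B' * lam"
  have b: "b > 1" "b < lam * x"
    using B' lam by (auto simp: b_def field_simps)
  obtain C where C: "C \<ge> 0" "\<And>v. 0 < norm v \<Longrightarrow> norm v < 1 \<Longrightarrow> norm (disc_fun v) \<le> C * norm (1 - v ^ m) powr (- b)"
    using disc_fun_bound[OF A B'0 bound'] unfolding b_def by blast
  obtain K where "\<And>n. norm ((deriv ^^ n) disc_fun 0 / fact n) \<le> K * (real n + 2) powr (b - 1)"
    using taylor_coefficient_bound_powr[OF m disc_fun_holomorphic b(1) C] by blast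
  then have K: "norm (dlam m lam a (Suc n)) \<le> K * (real n + 2) powr (b - 1)" for n
    by (simp add: fps_nth_fps_expansion[OF disc_fun_has_fps, symmetric] disc_fps_nth)
  have K0: "K \<ge> 0"
  proof -
    have "0 \<le> K * (real 0 + 2) powr (b - 1)" using K[of 0] norm_ge_zero order_trans by blast
    then show ?thesis by (simp add: zero_le_mult_iff)
  qed
  define X where "X = lam * x"
  have X: "X > 0" using b by (simp add: X_def)
  have GX: "Gamma X > 0" using X by (rule Gamma_real_pos)
  define D where "D = K * Gamma X * (4 * real m) powr X"
  have "summable (\<lambda>n. real n powr (b - 1 - X))"
    using b by (subst summable_real_powr_iff) (simp add: X_def)
  then have "summable (\<lambda>n. D * real (n + 2) powr (b - 1 - X))"
    by (intro summable_mult summable_ignore_initial_segment)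
  then show ?thesis
  \<comment> \<open>From n = 2 * m on, y - 1 is at least a fixed positive multiple of n + 2, so the
    Beta bound applies.\<close>
  proof (rule summable_comparison_test'[where N = "2 * m"])
    fix n assume n: "n \<ge> 2 * m"
    define y where "y = real (Suc n) / real m"
    have y1: "y - 1 \<ge> (real n + 2) / (4 * real m)"
    proof -
      have "y - 1 = (real n + 1 - real m) / real m" using m by (simp add: y_def field_simps)
      moreover have "(real n + 2) / (4 * real m) = ((real n + 2) / 4) / real m" by simp
      moreover have "(real n + 2) / 4 \<le> real n + 1 - real m" using n by simp
      ultimately show ?thesis using m by (simp only: divide_right_mono of_nat_0_le_iff)
    qed
    have pos: "(real n + 2) / (4 * real m) > 0" using m by simp
    have Bpos: "Beta y X \<ge> 0"
      using m X by (auto simp: Beta_def y_def intro!: divide_nonneg_nonneg mult_nonneg_nonneg less_imp_le[OF Gamma_real_pos] add_pos_pos)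
    have "Beta y X \<le> Gamma X * (y - 1) powr (- X)"
      using y1 pos by (intro Beta_real_le X) linarith
    also have "\<dots> \<le> Gamma X * ((real n + 2) / (4 * real m)) powr (- X)"
      using GX X pos y1 by (intro mult_left_mono powr_mono2') auto
    also have "((real n + 2) / (4 * real m)) powr (- X) = (4 * real m) powr X * (real n + 2) powr (- X)"
      using m by (simp add: powr_divide powr_minus_divide)
    finally have Ble: "Beta y X \<le> Gamma X * ((4 * real m) powr X * (real n + 2) powr (- X))" .
    have "norm (norm (dlam m lam a (Suc n)) * Beta y X) = norm (dlam m lam a (Suc n)) * Beta y X"
      using Bpos by simp
    also have "\<dots> \<le> (K * (real n + 2) powr (b - 1)) * (Gamma X * ((4 * real m) powr X * (real n + 2) powr (- X)))"
      using K0 by (intro mult_mono K Ble Bpos) auto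
    also have "\<dots> = D * real (n + 2) powr (b - 1 - X)"
    proof -
      have "(real n + 2) powr (b - 1 - X) = (real n + 2) powr (b - 1) * (real n + 2) powr (- X)"
        by (simp flip: powr_add)
      then show ?thesis by (simp add: D_def mult_ac add.commute)
    qed
    finally show "norm (norm (dlam m lam a (Suc n)) * Beta (real (Suc n) / real m) (lam * x)) \<le> D * real (n + 2) powr (b - 1 - X)"
      by (simp only: X_def y_def)
  qed
qed

text \<open>Taking norms replaces z by Re z in the kernel, so the integrated norms are lam * |d| *
  Beta at real arguments, summable by \<open>summable_dlam_Beta\<close>. This licenses exchanging
  sum and integral, and |integral of f| \<le> integral of |f| gives absolute convergence of the
  factorial series.\<close>

lemma factorial_series_eq_laplace:
  assumes A: "A \<ge> 0" and B: "B > 0" and z: "Re z > max B (1 / lam)"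
    and bound: "\<And>w. w \<in> Omega_log lam \<Longrightarrow>
      norm (g w * exp (complex_of_real ((real m - 1) / real m) * w)) \<le> A * exp (B * norm (exp w))"
  defines "h \<equiv> \<lambda>s. g (complex_of_real (ln s)) * exp (- z * complex_of_real s)"
  shows "summable (\<lambda>n. norm (fact_term m lam a z (Suc n)))"
    and "h absolutely_integrable_on {0<..}"
    and "(\<lambda>n. of_real lam * fact_term m lam a z (Suc n)) sums integral {0<..} h"
proof -
  define M where "M = lebesgue_on {0::real<..}"
  have spM: "space M = {0<..}" by (simp add: M_def)
  define d where "d = (\<lambda>n. dlam m lam a (Suc n))"
  define y where "y = (\<lambda>n. real (Suc n) / real m)"
  have y: "y n > 0" for n using m by (simp add: y_def)
  have x: "Re z > 0" using z B by auto
  define e where "e = (\<lambda>n s. (1 - exp (- s / lam)) powr (y n - 1))"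
  define f where "f = (\<lambda>n s. d n * (complex_of_real (e n s) * exp (- z * of_real s)))"
  have int: "integrable M (f n)" for n
    using has_absolute_integral_Beta_exp_complex(1)[OF lam x y] by (simp add: f_def M_def e_def)
  have I: "integral\<^sup>L M (f n) = of_real lam * fact_term m lam a z (Suc n)" for n
  proof -
    have "integral\<^sup>L M (f n) = d n * (of_real lam * Beta (of_real (y n)) (of_real lam * z))"
      using has_absolute_integral_Beta_exp_complex(2)[OF lam x y, of n] by (simp add: f_def M_def e_def)
    then show ?thesis
      by (simp add: fact_term_def Beta_def d_def y_def Gamma_complex_of_real[symmetric] add.commute)
  qed
  have nf: "norm (f n s) = norm (d n) * (e n s * exp (- Re z * s))" for n s
    by (simp add: f_def norm_mult e_def)
  have nI: "(LINT s|M. norm (f n s)) = lam * (norm (d n) * Beta (y n) (lam * Re z))" for n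
    unfolding nf using has_absolute_integral_Beta_exp_real(2)[OF lam x y, of n] by (simp add: M_def e_def)
  have sI: "summable (\<lambda>n. LINT s|M. norm (f n s))"
    unfolding nI d_def y_def by (intro summable_mult summable_dlam_Beta[OF A B z bound])
  have fs: "(\<lambda>n. f n s) sums h s" "summable (\<lambda>n. norm (f n s))" if "s > 0" for s
  proof -
    show "(\<lambda>n. f n s) sums h s"
      using sums_mult2[OF borel_ray_sums(1)[OF that], of "exp (- z * of_real s)"]
      by (simp add: f_def h_def d_def e_def y_def mult.assoc)
    have "(\<lambda>n. norm (f n s)) = (\<lambda>n. norm (dlam m lam a (Suc n) * of_real ((1 - exp (- s / lam)) powr (real (Suc n) / real m - 1))) * exp (- Re z * s))"
      by (simp add: nf norm_mult d_def e_def y_def mult.assoc fun_eq_iff)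
    then show "summable (\<lambda>n. norm (f n s))"
      using summable_mult2[OF borel_ray_sums(2)[OF that], of "exp (- Re z * s)"] by simp
  qed
  have AE: "AE s in M. summable (\<lambda>n. norm (f n s))"
    using fs(2) by (intro AE_I2) (auto simp: spM)
  have heq: "h s = (\<Sum>n. f n s)" if "s \<in> space M" for s
    using fs(1)[of s] that by (simp add: spM sums_unique)
  have hint: "integrable M h"
    using integrable_suminf[OF int AE sI] by (subst Bochner_Integration.integrable_cong[OF refl heq]) auto
  have hs: "(\<lambda>n. integral\<^sup>L M (f n)) sums integral\<^sup>L M h"
    using sums_integral[OF int AE sI] by (subst Bochner_Integration.integral_cong[OF refl heq]) auto
  show habs: "h absolutely_integrable_on {0<..}"
    using hint by (simp add: set_integrable_eq M_def)
  have "integral\<^sup>L M h = integral {0<..} h"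
    using set_lebesgue_integral_eq_integral(2)[OF habs]
    by (simp add: set_lebesgue_integral_def integral_restrict_space M_def)
  with hs show "(\<lambda>n. of_real lam * fact_term m lam a z (Suc n)) sums integral {0<..} h"
    unfolding I by simp
  have "summable (\<lambda>n. norm (integral\<^sup>L M (f n)))"
    by (rule summable_comparison_test'[OF sI]) (simp add: integral_norm_bound)
  then have "summable (\<lambda>n. (1 / lam) * norm (of_real lam * fact_term m lam a z (Suc n)))"
    unfolding I by (rule summable_mult)
  then show "summable (\<lambda>n. norm (fact_term m lam a z (Suc n)))"
    using lam by (simp add: norm_mult)
qed

end

text \<open>The projection maps P(max(B, 1/lam)) bijectively onto a half plane, so z is an ordinary
  complex number; the ray arg zeta = 0 is w = ln s with s > 0.\<close>

theorem theorem5p6: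
  fixes m :: nat and a :: "nat \<Rightarrow> complex" and lam A B :: real and g :: "complex \<Rightarrow> complex"
  assumes m: "m \<ge> 1"
    and gev: "gevrey1 m a"
    and lam: "lam > 0"
    and hol: "g holomorphic_on Omega_log lam"
    and per: "\<forall>w \<in> Omega_log lam. g (w + 2 * pi * \<i> * of_nat m) = g w"
    and ext: "\<exists>\<rho>>0. \<forall>w. Re w < ln \<rho> \<longrightarrow> w \<in> Omega_log lam \<and> borel_term m a w sums g w"
    and A: "A > 0" and B: "B > 0"
    and bound: "\<forall>w \<in> Omega_log lam.
        norm (g w * exp (complex_of_real ((real m - 1) / real m) * w)) \<le> A * exp (B * norm (exp w))"
  shows "\<forall>z. Re z > max B (1 / lam) \<longrightarrow>
           summable (\<lambda>n. norm (fact_term m lam a z (Suc n))) \<and>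
           (\<lambda>s. g (complex_of_real (ln s)) * exp (- z * complex_of_real s)) absolutely_integrable_on {0<..} \<and>
           a 0 + complex_of_real lam * (\<Sum>n. fact_term m lam a z (Suc n))
             = a 0 + integral {0<..} (\<lambda>s. g (complex_of_real (ln s)) * exp (- z * complex_of_real s))"
proof (intro allI impI)
  fix z :: complex assume z: "Re z > max B (1 / lam)"
  interpret borel_disc m a lam g
    by unfold_locales (use m lam hol per ext in auto)
  note * = factorial_series_eq_laplace[OF less_imp_le[OF A] B z bound[rule_format]]
  have "complex_of_real lam * (\<Sum>n. fact_term m lam a z (Suc n)) =
      (\<Sum>n. complex_of_real lam * fact_term m lam a z (Suc n))"
    by (rule suminf_mult[symmetric]) (rule summable_norm_cancel[OF *(1)])
  also have "\<dots> = integral {0<..} (\<lambda>s. g (complex_of_real (ln s)) * exp (- z * complex_of_real s))"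
    by (rule sums_unique[OF *(3), symmetric])
  finally show "summable (\<lambda>n. norm (fact_term m lam a z (Suc n))) \<and>
           (\<lambda>s. g (complex_of_real (ln s)) * exp (- z * complex_of_real s)) absolutely_integrable_on {0<..} \<and>
           a 0 + complex_of_real lam * (\<Sum>n. fact_term m lam a z (Suc n))
             = a 0 + integral {0<..} (\<lambda>s. g (complex_of_real (ln s)) * exp (- z * complex_of_real s))"
    using *(1,2) by simp
qed

end
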